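(* Let $\mu_{i,j}$ ($i,j\in\mathbb{N}$) be skew-symmetric bi-moments depending smoothly on times $t=(t_1,t_2,\ldots)$ with $$\partial_{t_n}\mu_{i,j}=\mu_{i+n,j}+\mu_{i,j+n}\qquad (n\ge1,\ i,j\in\mathbb{N}),$$ and assume $\tau_{2n}^{(m)}\neq0$ for all $n,m\in\mathbb{N}$. Then for all $n,m\in\mathbb{N}$ and $0\le \ell\le 2n+1$ the tau functions satisfy the bilinear identities (DKP, or Pfaff lattice, hierarchy) \begin{align*} \tau_{2n}^{(m+1)}&s_{2n+1-\ell}(-\tilde{\partial}_t)\tau_{2n}^{(m)}+\tau_{2n}^{(m+1)}\partial_{t_1}s_{2n-\ell}(-\tilde{\partial}_t)\tau_{2n}^{(m)}-\left(\partial_{t_1}\tau_{2n}^{(m+1)}\right)s_{2n-\ell}(-\tilde{\partial}_t)\tau_{2n}^{(m)}\\ &=\tau_{2n}^{(m)}s_{2n+1-\ell}(-\tilde{\partial}_t)\tau_{2n}^{(m+1)}-\tau_{2n+2}^{(m)}s_{2n-1-\ell}(-\tilde{\partial}_t)\tau_{2n-2}^{(m+1)}. \end{align*}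
   Context: $\mathbb{N}=\{0,1,2,\ldots\}$; $\mu_{i,j}=-\mu_{j,i}$ are real-valued. $\tau_{2n}^{(m)}=\mathrm{Pf}(m,m+1,\ldots,m+2n-1)$ is the Pfaffian of the $2n\times 2n$ skew-symmetric matrix $(\mu_{m+a,m+b})_{a,b=0}^{2n-1}$, with $\tau_0^{(m)}=1$ and the convention $\tau_{-2}^{(m)}=0$. The (elementary) Schur polynomials $s_k$ are defined by $\exp\left(\sum_{l\ge1}t_l z^l\right)=\sum_{k\ge0}s_k(t)z^k$, with $s_k=0$ for $k<0$. $\tilde\partial_t=(\partial_{t_1},\tfrac12\partial_{t_2},\tfrac13\partial_{t_3},\ldots)$, and $s_k(-\tilde\partial_t)$ is the differential operator obtained by substituting $t_l\mapsto -\tfrac1l\partial_{t_l}$ in $s_k$. *)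

theory Defs
  imports
    "HOL-Analysis.Analysis"
    "HOL-Combinatorics.Permutations"
    "HOL-Library.Poly_Mapping"
begin

section \<open>Functions of infinitely many times\<close>

text \<open>
  A point of time space is a function \<open>t :: nat \<Rightarrow> real\<close>, where \<open>t l\<close> is the time
  \<open>t\<^sub>l\<close> for \<open>l \<ge> 1\<close>. The entry \<open>t 0\<close> plays no role: no derivative is ever taken in it.
\<close>

type_synonym times = "nat \<Rightarrow> real"

definition time_slice :: "nat set \<Rightarrow> times \<Rightarrow> times set" where
  "time_slice A t = {t'. \<forall>l. l \<notin> A \<longrightarrow> t' l = t l}"

text \<open>
  For finite \<open>A\<close>, the product topology restricted to \<open>time_slice A t\<close> is the Euclidean topology
  of the finitely many times \<open>t\<^sub>l\<close>, \<open>l \<in> A\<close>. Openness and continuity are only required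
  on such slices; in the product topology on all of time space they would be far too restrictive
  (typical moments are not defined, or not continuous, on a product neighbourhood).
\<close>

definition open_in_times :: "times set \<Rightarrow> bool" where
  "open_in_times U \<longleftrightarrow>
     (\<forall>A t. finite A \<and> A \<subseteq> {1..} \<longrightarrow>
        openin (top_of_set (time_slice A t)) (U \<inter> time_slice A t))"

definition continuous_in_times :: "times set \<Rightarrow> (times \<Rightarrow> real) \<Rightarrow> bool" where
  "continuous_in_times U f \<longleftrightarrow>
     (\<forall>A t. finite A \<and> A \<subseteq> {1..} \<longrightarrow> continuous_on (U \<inter> time_slice A t) f)"

definition pderiv_t :: "nat \<Rightarrow> (times \<Rightarrow> real) \<Rightarrow> times \<Rightarrow> real" where
  "pderiv_t l f t = deriv (\<lambda>x. f (t(l := x))) (t l)"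

text \<open>
  \<open>f\<close> is smooth on \<open>U\<close> if all its iterated partial derivatives exist on \<open>U\<close> and are continuous
  functions of any finitely many times.
\<close>

definition smooth_in_times :: "times set \<Rightarrow> (times \<Rightarrow> real) \<Rightarrow> bool" where
  "smooth_in_times U f \<longleftrightarrow>
     (\<forall>ls. set ls \<subseteq> {1..} \<longrightarrow>
        continuous_in_times U (foldr pderiv_t ls f) \<and>
        (\<forall>t\<in>U. \<forall>l\<ge>1.
           (\<lambda>x. foldr pderiv_t ls f (t(l := x))) field_differentiable at (t l)))"


section \<open>Pfaffians and tau functions\<close>

definition pfaffian :: "nat \<Rightarrow> (nat \<Rightarrow> nat \<Rightarrow> real) \<Rightarrow> real" where
  "pfaffian n A =
     (\<Sum>p | p permutes {..<2*n}. of_int (sign p) * (\<Prod>i<n. A (p (2*i)) (p (2*i+1))))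
       / (2 ^ n * fact n)"

text \<open>
  \<open>tau mu k m\<close> is \<open>\<tau>\<close> with lower index \<open>2k\<close> and upper index \<open>m\<close>; the index \<open>k\<close> is an integer
  because \<open>k = -1\<close> occurs.
\<close>

definition tau :: "(nat \<Rightarrow> nat \<Rightarrow> times \<Rightarrow> real) \<Rightarrow> int \<Rightarrow> nat \<Rightarrow> times \<Rightarrow> real" where
  "tau mu k m t =
     (if k < 0 then 0 else pfaffian (nat k) (\<lambda>a b. mu (m + a) (m + b) t))"


section \<open>Schur polynomials and the associated differential operators\<close>

text \<open>
  Polynomials in the countably many variables \<open>t\<^sub>l\<close>: a monomial is the finitely supported map
  sending \<open>l\<close> to the exponent of \<open>t\<^sub>l\<close>.
\<close>

type_synonym tpoly = "(nat \<Rightarrow>\<^sub>0 nat) \<Rightarrow>\<^sub>0 real"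

definition tconst :: "real \<Rightarrow> tpoly" where
  "tconst c = Poly_Mapping.single 0 c"

definition tvar :: "nat \<Rightarrow> tpoly" where
  "tvar l = Poly_Mapping.single (Poly_Mapping.single l 1) 1"

text \<open>
  The exponential series is written out because \<^const>\<open>fps_exp\<close> needs a coefficient field.
\<close>

definition schur :: "int \<Rightarrow> tpoly" where
  "schur k =
     (if k < 0 then 0
      else fps_nth
        (fps_compose (Abs_fps (\<lambda>j. tconst (1 / fact j)))
                     (Abs_fps (\<lambda>l. if l = 0 then 0 else tvar l)))
        (nat k))"

text \<open>
  Substitution of operators \<open>D l\<close> for the variables \<open>t\<^sub>l\<close>. On arbitrary functions
  the operators need not commute, so each monomial is composed in increasing order
  of the index \<open>l\<close>; on smooth functions the order is irrelevant.
\<close>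

definition subst_monom ::
  "(nat \<Rightarrow> (times \<Rightarrow> real) \<Rightarrow> times \<Rightarrow> real) \<Rightarrow> (nat \<Rightarrow>\<^sub>0 nat) \<Rightarrow>
     (times \<Rightarrow> real) \<Rightarrow> times \<Rightarrow> real" where
  "subst_monom D a =
     foldr (\<lambda>l F. (D l ^^ Poly_Mapping.lookup a l) \<circ> F)
       (sorted_list_of_set (Poly_Mapping.keys a)) id"

definition subst_tpoly ::
  "(nat \<Rightarrow> (times \<Rightarrow> real) \<Rightarrow> times \<Rightarrow> real) \<Rightarrow> tpoly \<Rightarrow>
     (times \<Rightarrow> real) \<Rightarrow> times \<Rightarrow> real" where
  "subst_tpoly D P f t =
     (\<Sum>a\<in>Poly_Mapping.keys P. Poly_Mapping.lookup P a * subst_monom D a f t)"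

text \<open>The operator \<open>s\<^sub>k(-\<partial>\<^sub>t)\<close>, with \<open>\<partial>\<^sub>t\<close> carrying the weights \<open>1 / l\<close>.\<close>

definition schur_op :: "int \<Rightarrow> (times \<Rightarrow> real) \<Rightarrow> times \<Rightarrow> real" where
  "schur_op k = subst_tpoly (\<lambda>l f t. - (1 / real l) * pderiv_t l f t) (schur k)"

end

(*
  By Newton's identities, s_k(-d) acts on a Pfaffian in its index shifts as (-1)^k times the
  k-th elementary symmetric polynomial. Since a Pfaffian with a repeated index vanishes, only one
  term survives on consecutive indices:
    s_k(-d) Pf(m, ..., m+2n-1) = (-1)^k Pf(m, ..., m+2n) with the index m+2n-k omitted,
  and this is 0 for k > 2n. For 0 < l < 2n the bilinear identity thereby becomes the four-term
  Pfaffian Pluecker relation with base {m+1, ..., m+2n-1} - {m+l} and the extra indices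
  m, m+l, m+2n, m+2n+1; for the remaining l it degenerates to a trivial one.
*)
theory Submission
  imports Defs
begin

section \<open>Pfaffians\<close>

text \<open>By the evolution equation, d/dt_l turns a Pfaffian into the sum of the Pfaffians with
  one index raised by l, so it acts as the power sum of the x_i^l in commuting index shifts x_i.
  Substituting t_l = -(sum of the x_i^l)/l in exp(sum t_l z^l) gives the product of the 1 - x_i z;
  this is the origin of the signed elementary symmetric polynomials. The shifts are not operators on
  functions of t, because a Pfaffian as a function does not determine its indices; hence Newton's
  identities are carried out on explicit sums over sets of raised positions. In the bilinear
  identity put p = m + l with 0 < l < 2n. The first summand carries the Pfaffian with gap p - 1.
  Differentiating the Pfaffian with gap p gives two terms: either the index p - 1 moves up into the
  gap, or the last index moves up. The former has the opposite sign and cancels the first summand;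
  the products that remain are those of the Pluecker relation.\<close>

definition pfaffian_term :: "nat \<Rightarrow> (nat \<Rightarrow> nat \<Rightarrow> real) \<Rightarrow> (nat \<Rightarrow> nat) \<Rightarrow> real" where
  "pfaffian_term n A p = of_int (sign p) * (\<Prod>i<n. A (p (2*i)) (p (2*i+1)))"

lemma pfaffian_eq_sum_term:
  "pfaffian n A = (\<Sum>p | p permutes {..<2*n}. pfaffian_term n A p) / (2 ^ n * fact n)"
  by (simp add: pfaffian_def pfaffian_term_def)

lemma pfaffian_cong:
  assumes "\<And>a b. a < 2*n \<Longrightarrow> b < 2*n \<Longrightarrow> A a b = B a b"
  shows "pfaffian n A = pfaffian n B"
proof -
  have "pfaffian_term n A p = pfaffian_term n B p" if "p permutes {..<2*n}" for p
  proof -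
    have "A (p (2*i)) (p (2*i+1)) = B (p (2*i)) (p (2*i+1))" if "i < n" for i
      using permutes_in_image[OF \<open>p permutes _\<close>, of "2*i"]
        permutes_in_image[OF \<open>p permutes _\<close>, of "2*i+1"] that by (intro assms) auto
    then show ?thesis
      by (simp add: pfaffian_term_def)
  qed
  then show ?thesis
    by (simp add: pfaffian_eq_sum_term)
qed

text \<open>Reindexing the sum by \<open>q \<circ> p\<close> moves \<open>q\<close> into the entries
  at the cost of \<open>sign q\<close>, which is its own inverse.\<close>

lemma pfaffian_permute:
  assumes q: "q permutes {..<2*n}"
  shows "pfaffian n (\<lambda>a b. A (q a) (q b)) = of_int (sign q) * pfaffian n A"
proof -
  have "(\<Sum>p | p permutes {..<2*n}. pfaffian_term n A p) =
        (\<Sum>p | p permutes {..<2*n}. pfaffian_term n A (q \<circ> p))"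
    using q by (rule setum_permutations_compose_left)
  also have "\<dots> = (\<Sum>p | p permutes {..<2*n}.
                   of_int (sign q) * pfaffian_term n (\<lambda>a b. A (q a) (q b)) p)"
  proof (rule sum.cong[OF refl])
    fix p assume "p \<in> {p. p permutes {..<2*n}}"
    then have "sign (q \<circ> p) = sign q * sign p"
      using q by (intro sign_compose) (auto intro: permutation_permutes[THEN iffD2] exI[of _ "{..<2*n}"])
    then show "pfaffian_term n A (q \<circ> p) = of_int (sign q) * pfaffian_term n (\<lambda>a b. A (q a) (q b)) p"
      by (simp add: pfaffian_term_def)
  qed
  finally have *: "(\<Sum>p | p permutes {..<2*n}. pfaffian_term n A p) = of_int (sign q) *
      (\<Sum>p | p permutes {..<2*n}. pfaffian_term n (\<lambda>a b. A (q a) (q b)) p)"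
    by (simp add: sum_distrib_left)
  have "of_int (sign q) * (of_int (sign q) * x) = x" for x :: real
    by (metis mult.assoc mult_1 of_int_1 of_int_mult sign_idempotent)
  then show ?thesis
    by (simp add: pfaffian_eq_sum_term *)
qed

lemma pfaffian_swap:
  assumes "i < 2*n" "j < 2*n" "i \<noteq> j"
  shows "pfaffian n (\<lambda>a b. A (Transposition.transpose i j a) (Transposition.transpose i j b)) = - pfaffian n A"
  using pfaffian_permute[OF permutes_swap_id, of i n j A] assms by (simp add: sign_swap_id)

text \<open>Swapping the two positions negates the Pfaffian but leaves its entries alone, so it
  equals its own negative.\<close>

lemma pfaffian_repeated_index:
  assumes "i < 2*n" "j < 2*n" "i \<noteq> j" "f i = f j"
  shows "pfaffian n (\<lambda>a b. A (f a) (f b)) = 0"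
proof -
  have "f (Transposition.transpose i j a) = f a" for a
    using assms(4) by (cases "a = i"; cases "a = j") auto
  then show ?thesis
    using pfaffian_swap[OF assms(1-3), of "\<lambda>a b. A (f a) (f b)"] by simp
qed

section \<open>Symmetries of the terms and expansion along the last index\<close>

lemma pfaffian_term_flip:
  assumes skew: "\<And>a b. A a b = - A b a" and p: "p permutes {..<2*n}" and i: "i < n"
  shows "pfaffian_term n A (p \<circ> Transposition.transpose (2*i) (2*i+1)) = pfaffian_term n A p"
proof -
  let ?t = "Transposition.transpose (2*i) (2*i+1)"
  have "(\<Prod>k<n. A (p (?t (2*k))) (p (?t (2*k+1)))) =
        A (p (2*i+1)) (p (2*i)) * (\<Prod>k\<in>{..<n}-{i}. A (p (?t (2*k))) (p (?t (2*k+1))))"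
    using i by (subst prod.remove[of _ i]) auto
  also have "(\<Prod>k\<in>{..<n}-{i}. A (p (?t (2*k))) (p (?t (2*k+1)))) =
             (\<Prod>k\<in>{..<n}-{i}. A (p (2*k)) (p (2*k+1)))"
  proof (rule prod.cong[OF refl])
    fix k assume "k \<in> {..<n} - {i}"
    then have "?t (2*k) = 2*k" "?t (2*k+1) = 2*k+1"
      by auto
    then show "A (p (?t (2*k))) (p (?t (2*k+1))) = A (p (2*k)) (p (2*k+1))"
      by simp
  qed
  also have "A (p (2*i+1)) (p (2*i)) * (\<Prod>k\<in>{..<n}-{i}. A (p (2*k)) (p (2*k+1))) =
             - (\<Prod>k<n. A (p (2*k)) (p (2*k+1)))"
    using i skew[of "p (2*i+1)" "p (2*i)"] by (subst prod.remove[of "{..<n}" i]) auto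
  finally have prod: "(\<Prod>k<n. A (p (?t (2*k))) (p (?t (2*k+1)))) = - (\<Prod>k<n. A (p (2*k)) (p (2*k+1)))" .
  have "permutation p"
    using p by (auto simp: permutation_permutes)
  \<comment> \<open>The flip also negates \<open>sign p\<close>, which cancels the minus sign that
    skew-symmetry gives the factor of pair \<open>i\<close>.\<close>
  then have "sign (p \<circ> ?t) = - sign p"
    by (simp add: sign_compose permutation_swap_id sign_swap_id)
  with prod show ?thesis
    by (simp add: pfaffian_term_def)
qed

text \<open>Exchanging two whole pairs only permutes the factors, and the two transpositions have
  total sign +1.\<close>

lemma pfaffian_term_swap_pairs:
  assumes p: "p permutes {..<2*n}" and ij: "i < n" "j < n"
  shows "pfaffian_term n A (p \<circ> (Transposition.transpose (2*i) (2*j) \<circ> Transposition.transpose (2*i+1) (2*j+1))) =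
         pfaffian_term n A p"
proof (cases "i = j")
  case False
  let ?s = "Transposition.transpose (2*i) (2*j) \<circ> Transposition.transpose (2*i+1) (2*j+1)"
  let ?t = "Transposition.transpose i j"
  have s: "?s (2*k) = 2 * ?t k" "?s (2*k+1) = 2 * ?t k + 1" for k
    by (auto simp: Transposition.transpose_def)
  have "(\<Prod>k<n. A (p (2*k)) (p (2*k+1))) = prod ((\<lambda>k. A (p (2*k)) (p (2*k+1))) \<circ> ?t) {..<n}"
    using ij by (intro prod.permute permutes_swap_id) auto
  also have "\<dots> = (\<Prod>k<n. A (p (?s (2*k))) (p (?s (2*k+1))))"
    unfolding s by simp
  finally have prod: "(\<Prod>k<n. A (p (?s (2*k))) (p (?s (2*k+1)))) = (\<Prod>k<n. A (p (2*k)) (p (2*k+1)))" ..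
  have "permutation p"
    using p by (auto simp: permutation_permutes)
  then have "sign (p \<circ> ?s) = sign p"
    using False by (simp add: sign_compose permutation_swap_id permutation_compose sign_swap_id)
  with prod show ?thesis
    by (simp add: pfaffian_term_def)
qed simp

text \<open>The permutations that respect the pairing {2i, 2i+1} act transitively on the positions
  and preserve every term. A pair exchange links the last pair with the pair of \<open>r\<close>; a
  flip inside that pair is added when \<open>r\<close> is even.\<close>

lemma pfaffian_term_move_to_last:
  assumes skew: "\<And>a b. A a b = - A b a" and r: "r < 2 * Suc n"
  obtains \<pi> where "\<pi> permutes {..<2 * Suc n}" "\<pi> (2*n+1) = r"
    "\<And>p. p permutes {..<2 * Suc n} \<Longrightarrow> pfaffian_term (Suc n) A (p \<circ> \<pi>) = pfaffian_term (Suc n) A p"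
proof -
  define i where "i = r div 2"
  define s where "s = Transposition.transpose (2*i) (2*n) \<circ> Transposition.transpose (2*i+1) (2*n+1)"
  define f where "f = Transposition.transpose (2*i) (2*i+1)"
  have i: "i < Suc n"
    using r by (auto simp: i_def)
  then have s_perm: "s permutes {..<2 * Suc n}"
    unfolding s_def by (intro permutes_compose permutes_swap_id) auto
  have f_perm: "f permutes {..<2 * Suc n}"
    using i unfolding f_def by (intro permutes_swap_id) auto
  have s_last: "s (2*n+1) = 2*i+1"
    by (auto simp: s_def Transposition.transpose_def)
  have s_inv: "pfaffian_term (Suc n) A (p \<circ> s) = pfaffian_term (Suc n) A p"
    if "p permutes {..<2 * Suc n}" for p
    unfolding s_def using that i by (intro pfaffian_term_swap_pairs) auto
  have f_inv: "pfaffian_term (Suc n) A (p \<circ> f) = pfaffian_term (Suc n) A p"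
    if "p permutes {..<2 * Suc n}" for p
    unfolding f_def using that i by (intro pfaffian_term_flip skew) auto
  show thesis
  proof (cases "even r")
    case False
    then have "2*i+1 = r"
      by (simp add: i_def)
    then show ?thesis
      using that[of s] s_perm s_last s_inv by simp
  next
    case True
    then have "f (2*i+1) = r"
      by (simp add: f_def i_def)
    moreover have "pfaffian_term (Suc n) A (p \<circ> (f \<circ> s)) = pfaffian_term (Suc n) A p"
      if "p permutes {..<2 * Suc n}" for p
      using s_inv[of "p \<circ> f"] f_inv[OF that] permutes_compose[OF f_perm that]
      by (simp add: o_assoc)
    ultimately show ?thesis
      using that[of "f \<circ> s"] permutes_compose[OF s_perm f_perm] s_last by simp
  qed
qed

text \<open>The factor of the last pair is split off: \<open>c\<close> is the value at position 2n,
  hence the partner of the last index. The remaining factors see only \<open>q\<close>, with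
  \<open>c\<close> and 2n interchanged.\<close>

lemma pfaffian_term_transpose_last:
  assumes q: "q permutes {..<2*n}" and c: "c \<le> 2*n"
  shows "pfaffian_term (Suc n) A (Transposition.transpose (2*n) c \<circ> q) =
    (if c = 2*n then 1 else -1) * A c (2*n+1) *
    pfaffian_term n (\<lambda>a b. A (Transposition.transpose (2*n) c a) (Transposition.transpose (2*n) c b)) q"
proof -
  have fix_q: "q (2*n) = 2*n" "q (2*n+1) = 2*n+1"
    using permutes_not_in[OF q] by auto
  have "permutation q"
    using q by (auto simp: permutation_permutes)
  then have "sign (Transposition.transpose (2*n) c \<circ> q) = (if c = 2*n then 1 else -1) * sign q"
    by (simp add: sign_compose permutation_swap_id sign_swap_id)
  moreover have "Transposition.transpose (2*n) c (2*n+1) = 2*n+1"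
    using c by (intro transpose_apply_other) auto
  ultimately show ?thesis
    using fix_q by (simp add: pfaffian_term_def)
qed

text \<open>
  The factors \<open>\<plusminus>1\<close> are not alternating because row \<open>c\<close> is replaced by row \<open>2 n\<close>
  instead of being deleted.
\<close>

lemma pfaffian_expand_last:
  assumes skew: "\<And>a b. A a b = - A b a"
  shows "pfaffian (Suc n) A = (\<Sum>c\<le>2*n. (if c = 2*n then 1 else -1) * A c (2*n+1) *
           pfaffian n (\<lambda>a b. A (Transposition.transpose (2*n) c a) (Transposition.transpose (2*n) c b)))"
proof -
  let ?S = "{..<2 * Suc n}" and ?T = "pfaffian_term (Suc n) A" and ?L = "2*n+1"
  let ?B = "\<lambda>c a b. A (Transposition.transpose (2*n) c a) (Transposition.transpose (2*n) c b)"
  let ?e = "\<lambda>c. if c = 2*n then 1 else -1 :: real"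
  have fin: "finite {p. p permutes ?S}"
    by (simp add: finite_permutations)
  \<comment> \<open>The permutations are sorted by the position \<open>r\<close> at which the value
    2n+1 stands. Composing with a symmetry of the pairing moves this position to the end, so all
    fibres have the same sum.\<close>
  have fiber: "(\<Sum>p | p permutes ?S \<and> p r = ?L. ?T p) = (\<Sum>p | p permutes ?S \<and> p ?L = ?L. ?T p)"
    if r: "r \<in> ?S" for r
  proof -
    obtain \<pi> where \<pi>: "\<pi> permutes ?S" "\<pi> ?L = r"
      and inv: "\<And>p. p permutes ?S \<Longrightarrow> ?T (p \<circ> \<pi>) = ?T p"
      using pfaffian_term_move_to_last[of A, OF skew, of r n] r unfolding lessThan_iff by blast
    show ?thesis
    proof (rule sum.reindex_bij_witness[of _ "\<lambda>p. p \<circ> inv \<pi>" "\<lambda>p. p \<circ> \<pi>"])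
      fix p assume p: "p \<in> {p. p permutes ?S \<and> p r = ?L}"
      show "(p \<circ> \<pi>) \<circ> inv \<pi> = p"
        by (simp add: o_assoc[symmetric] permutes_inv_o[OF \<pi>(1)])
      show "p \<circ> \<pi> \<in> {p. p permutes ?S \<and> p ?L = ?L}"
        using p \<pi> permutes_compose[of \<pi> ?S p] by simp
      show "?T (p \<circ> \<pi>) = ?T p"
        using p inv by simp
    next
      fix p assume p: "p \<in> {p. p permutes ?S \<and> p ?L = ?L}"
      show "(p \<circ> inv \<pi>) \<circ> \<pi> = p"
        by (simp add: o_assoc[symmetric] permutes_inv_o[OF \<pi>(1)])
      have "inv \<pi> r = ?L"
        using \<pi> by (metis permutes_inverses(2))
      then show "p \<circ> inv \<pi> \<in> {p. p permutes ?S \<and> p r = ?L}"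
        using p permutes_compose[OF permutes_inv[OF \<pi>(1)], of p] by simp
    qed
  qed
  have "(\<Sum>p | p permutes ?S. ?T p) = (\<Sum>p | p permutes ?S. \<Sum>r | r \<in> ?S \<and> p r = ?L. ?T p)"
  proof (rule sum.cong[OF refl])
    fix p assume "p \<in> {p. p permutes ?S}"
    then have p: "p permutes ?S" by simp
    have "inv p ?L \<in> ?S"
      using permutes_in_image[OF permutes_inv[OF p], of ?L] by simp
    moreover have "p r = ?L \<longleftrightarrow> r = inv p ?L" for r
      using permutes_inv_eq[OF p, of ?L r] by (simp only: eq_commute[of r])
    ultimately have "{r. r \<in> ?S \<and> p r = ?L} = {inv p ?L}"
      by (simp only: set_eq_iff mem_Collect_eq singleton_iff) blast
    then show "?T p = (\<Sum>r | r \<in> ?S \<and> p r = ?L. ?T p)"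
      by simp
  qed
  also have "\<dots> = (\<Sum>r\<in>?S. \<Sum>p | p permutes ?S \<and> p r = ?L. ?T p)"
    using sum.swap_restrict[OF fin, of ?S "\<lambda>p r. ?T p" "\<lambda>p r. p r = ?L"]
    by (simp del: mult_Suc_right)
  also have "\<dots> = (\<Sum>r\<in>?S. \<Sum>p | p permutes ?S \<and> p ?L = ?L. ?T p)"
    by (rule sum.cong[OF refl fiber])
  also have "\<dots> = real (2 * Suc n) * (\<Sum>p | p permutes ?S \<and> p ?L = ?L. ?T p)"
    unfolding sum_constant card_lessThan ..
  also have "{p. p permutes ?S \<and> p ?L = ?L} = {p. p permutes insert (2*n) {..<2*n}}"
  proof (intro equalityI subsetI)
    fix p assume "p \<in> {p. p permutes ?S \<and> p ?L = ?L}"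
    then have p: "p permutes ?S" and "p ?L = ?L" by auto
    then have "p permutes insert (2*n) {..<2*n}"
      using permutes_superset[OF p, of "insert (2*n) {..<2*n}"] by (auto simp: less_Suc_eq)
    then show "p \<in> {p. p permutes insert (2*n) {..<2*n}}"
      by simp
  next
    fix p assume "p \<in> {p. p permutes insert (2*n) {..<2*n}}"
    then have p: "p permutes insert (2*n) {..<2*n}" by simp
    then have "p permutes ?S"
      by (rule permutes_subset) auto
    moreover have "p ?L = ?L"
      using p by (rule permutes_not_in) auto
    ultimately show "p \<in> {p. p permutes ?S \<and> p ?L = ?L}" by simp
  qed
  also have "sum ?T {p. p permutes insert (2*n) {..<2*n}} =
      (\<Sum>c\<in>insert (2*n) {..<2*n}. \<Sum>q | q permutes {..<2*n}. ?T (Transposition.transpose (2*n) c \<circ> q))"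
    by (rule sum_over_permutations_insert) auto
  also have "insert (2*n) {..<2*n} = {..2*n}"
    by auto
  also have "(\<Sum>c\<le>2*n. \<Sum>q | q permutes {..<2*n}. ?T (Transposition.transpose (2*n) c \<circ> q)) =
      (\<Sum>c\<le>2*n. \<Sum>q | q permutes {..<2*n}. ?e c * A c ?L * pfaffian_term n (?B c) q)"
    by (intro sum.cong refl pfaffian_term_transpose_last) auto
  also have "\<dots> = (\<Sum>c\<le>2*n. ?e c * A c ?L * (pfaffian n (?B c) * (2 ^ n * fact n)))"
    unfolding sum_distrib_left[symmetric] pfaffian_eq_sum_term by simp
  also have "\<dots> = (\<Sum>c\<le>2*n. ?e c * A c ?L * pfaffian n (?B c)) * (2 ^ n * fact n)"
    unfolding sum_distrib_right mult.assoc ..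
  finally have "(\<Sum>p | p permutes ?S. ?T p) =
      real (2 * Suc n) * ((\<Sum>c\<le>2*n. ?e c * A c ?L * pfaffian n (?B c)) * (2 ^ n * fact n))" .
  \<comment> \<open>The number 2(n+1) of fibres is exactly the factor by which the normalisation 2^n
    n! grows from n to n+1.\<close>
  moreover have "real (2 * Suc n) * (s * (2 ^ n * fact n)) / (2 ^ Suc n * fact (Suc n)) = s" for s :: real
  proof -
    have "(2 ^ Suc n * fact (Suc n) :: real) = real (2 * Suc n) * (2 ^ n * fact n)"
      by (simp add: algebra_simps)
    then show ?thesis by simp
  qed
  ultimately show ?thesis
    unfolding pfaffian_eq_sum_term[of "Suc n"] by (simp only:)
qed

text \<open>With indices in a list, omitting, inserting and moving them becomes concatenation. In a
  list of odd length the division by 2 drops the last entry, whence the parity hypotheses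
  below.\<close>

definition pfaffian_list :: "('a \<Rightarrow> 'a \<Rightarrow> real) \<Rightarrow> 'a list \<Rightarrow> real" where
  "pfaffian_list M xs = pfaffian (length xs div 2) (\<lambda>a b. M (xs ! a) (xs ! b))"

lemma pfaffian_list_map:
  "pfaffian_list M (map f [0..<2*n]) = pfaffian n (\<lambda>a b. M (f a) (f b))"
  by (auto simp: pfaffian_list_def intro: pfaffian_cong)

lemma pfaffian_list_not_distinct:
  assumes "even (length xs)" "\<not> distinct xs"
  shows "pfaffian_list M xs = 0"
proof -
  obtain i j where "i < length xs" "j < length xs" "i \<noteq> j" "xs ! i = xs ! j"
    using assms(2) by (auto simp: distinct_conv_nth)
  then show ?thesis
    using assms(1) pfaffian_repeated_index[of i "length xs div 2" j "(!) xs" M]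
    by (simp add: pfaffian_list_def)
qed

lemma pfaffian_list_swap_adjacent:
  assumes "even (length xs + length ys)"
  shows "pfaffian_list M (xs @ x # y # ys) = - pfaffian_list M (xs @ y # x # ys)"
proof -
  let ?i = "length xs" and ?zs = "xs @ y # x # ys"
  let ?t = "Transposition.transpose ?i (Suc ?i)"
  have len: "2 * (length ?zs div 2) = length ?zs"
    using assms by simp
  have "(xs @ x # y # ys) ! a = ?zs ! ?t a" for a
    by (auto simp: nth_append nth_Cons' Transposition.transpose_def)
  then have "pfaffian_list M (xs @ x # y # ys) =
      pfaffian (length ?zs div 2) (\<lambda>a b. M (?zs ! ?t a) (?zs ! ?t b))"
    by (simp add: pfaffian_list_def)
  also have "\<dots> = - pfaffian_list M ?zs"
    unfolding pfaffian_list_def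
    using len by (intro pfaffian_swap[of _ _ _ "\<lambda>a b. M (?zs ! a) (?zs ! b)"]) auto
  finally show ?thesis .
qed

text \<open>\<open>x\<close> passes one entry of \<open>ys\<close> at a time, each passage giving a
  sign; the passed entry joins the prefix, so \<open>xs\<close> is arbitrary in the
  induction.\<close>

lemma pfaffian_list_move:
  assumes "odd (length xs + length ys + length zs)"
  shows "pfaffian_list M (xs @ x # ys @ zs) = (-1) ^ length ys * pfaffian_list M (xs @ ys @ x # zs)"
  using assms
proof (induction ys arbitrary: xs)
  case (Cons y ys)
  have "even (length xs + length (ys @ zs))"
    using Cons.prems by (simp only: list.size length_append) presburger
  then have "pfaffian_list M (xs @ x # (y # ys) @ zs) = - pfaffian_list M ((xs @ [y]) @ x # ys @ zs)"
    using pfaffian_list_swap_adjacent[of xs "ys @ zs" M x y] by simp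
  also have "\<dots> = (-1) ^ length (y # ys) * pfaffian_list M (xs @ (y # ys) @ x # zs)"
    using Cons.prems by (subst Cons.IH) auto
  finally show ?case .
qed simp

text \<open>\<open>butlast (xs[c := last xs])\<close> is the list form of the transposition of
  \<open>c\<close> with 2n: entry \<open>c\<close> is removed and the last entry takes its place.
  For \<open>c\<close> = 2n the last entry is just dropped.\<close>

lemma pfaffian_list_expand_last:
  assumes skew: "\<And>a b. M a b = - M b a" and len: "length xs = 2*n+1"
  shows "pfaffian_list M (xs @ [x]) = (\<Sum>c\<le>2*n. (if c = 2*n then 1 else -1) * M (xs ! c) x *
           pfaffian_list M (butlast (xs[c := last xs])))"
proof -
  let ?A = "\<lambda>a b. M ((xs @ [x]) ! a) ((xs @ [x]) ! b)"
  let ?t = "Transposition.transpose (2*n)"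
  have "pfaffian_list M (xs @ [x]) = pfaffian (Suc n) ?A"
    using len by (simp add: pfaffian_list_def)
  also have "\<dots> = (\<Sum>c\<le>2*n. (if c = 2*n then 1 else -1) * ?A c (2*n+1) *
           pfaffian n (\<lambda>a b. ?A (?t c a) (?t c b)))"
    by (rule pfaffian_expand_last) (rule skew)
  also have "\<dots> = (\<Sum>c\<le>2*n. (if c = 2*n then 1 else -1) * M (xs ! c) x *
           pfaffian_list M (butlast (xs[c := last xs])))"
  proof (rule sum.cong[OF refl])
    fix c assume "c \<in> {..2*n}"
    then have c: "c \<le> 2*n" by simp
    have "xs \<noteq> []"
      using len by auto
    then have "last xs = xs ! (2*n)"
      using len by (simp add: last_conv_nth)
    then have "(xs @ [x]) ! ?t c a = butlast (xs[c := last xs]) ! a" if "a < 2*n" for a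
      using that len c
      by (auto simp: nth_append nth_butlast nth_list_update Transposition.transpose_def)
    then have "pfaffian n (\<lambda>a b. ?A (?t c a) (?t c b)) = pfaffian_list M (butlast (xs[c := last xs]))"
      using len unfolding pfaffian_list_def by (auto intro!: pfaffian_cong)
    moreover have "?A c (2*n+1) = M (xs ! c) x"
      using len c by (simp add: nth_append)
    ultimately show "(if c = 2*n then 1 else -1) * ?A c (2*n+1) * pfaffian n (\<lambda>a b. ?A (?t c a) (?t c b)) =
        (if c = 2*n then 1 else -1) * M (xs ! c) x * pfaffian_list M (butlast (xs[c := last xs]))"
      by simp
  qed
  finally show ?thesis .
qed

text \<open>Both sides expand to the same double sum, up to the sign of the skew-symmetric \<open>M\<close>.\<close>

lemma pfaffian_list_exchange:
  assumes skew: "\<And>a b. M a b = - M b a"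
    and len: "length xs = 2*k+1" "length ys = 2*n+1"
  shows "(\<Sum>c\<le>2*k. (if c = 2*k then 1 else -1) * pfaffian_list M (butlast (xs[c := last xs])) *
            pfaffian_list M (ys @ [xs ! c])) =
       - (\<Sum>d\<le>2*n. (if d = 2*n then 1 else -1) * pfaffian_list M (butlast (ys[d := last ys])) *
            pfaffian_list M (xs @ [ys ! d]))" (is "?lhs = - ?rhs")
proof -
  let ?e = "\<lambda>m c. if c = 2*m then 1 else -1 :: real"
  let ?R = "\<lambda>zs c. pfaffian_list M (butlast (zs[c := last zs]))"
  have "?lhs = (\<Sum>c\<le>2*k. \<Sum>d\<le>2*n. (?e k c * ?R xs c) * (?e n d * ?R ys d) * M (ys ! d) (xs ! c))"
    unfolding pfaffian_list_expand_last[of M, OF skew len(2)] sum_distrib_left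
    by (intro sum.cong refl) (simp only: mult_ac)
  also have "\<dots> = (\<Sum>d\<le>2*n. \<Sum>c\<le>2*k. (?e k c * ?R xs c) * (?e n d * ?R ys d) * M (ys ! d) (xs ! c))"
    by (rule sum.swap)
  also have "\<dots> = (\<Sum>d\<le>2*n. \<Sum>c\<le>2*k. - ((?e n d * ?R ys d) * (?e k c * ?R xs c * M (xs ! c) (ys ! d))))"
    by (subst skew) (simp add: mult_ac)
  also have "\<dots> = - ?rhs"
    unfolding pfaffian_list_expand_last[of M, OF skew len(1)] sum_distrib_left sum_negf
    by (intro arg_cong[of _ _ uminus] sum.cong refl) (simp only: mult_ac)
  finally show ?thesis .
qed

text \<open>This is the exchange relation for the odd lists \<open>xs @ [a]\<close> and
  \<open>xs @ [b, c, d]\<close>. Exchanging an entry of \<open>xs\<close> repeats an index, so one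
  term survives on the left and three on the right.\<close>

lemma pfaffian_pluecker:
  assumes skew: "\<And>a b. M a b = - M b a" and len: "even (length xs)"
  shows "pfaffian_list M xs * pfaffian_list M (xs @ [a, b, c, d]) =
           pfaffian_list M (xs @ [a, b]) * pfaffian_list M (xs @ [c, d])
         - pfaffian_list M (xs @ [a, c]) * pfaffian_list M (xs @ [b, d])
         + pfaffian_list M (xs @ [a, d]) * pfaffian_list M (xs @ [b, c])"
proof -
  let ?P = "pfaffian_list M"
  obtain k where k: "length xs = 2*k"
    using len by blast
  let ?e = "\<lambda>m c. if c = 2*m then 1 else -1 :: real"
  let ?f = "\<lambda>i. ?e k i * ?P (butlast ((xs @ [a])[i := last (xs @ [a])])) *
              ?P ((xs @ [b, c, d]) @ [(xs @ [a]) ! i])"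
  let ?g = "\<lambda>i. ?e (Suc k) i * ?P (butlast ((xs @ [b, c, d])[i := last (xs @ [b, c, d])])) *
              ?P ((xs @ [a]) @ [(xs @ [b, c, d]) ! i])"
  have f0: "?f i = 0" if "i < 2*k" for i
  proof -
    have "(xs @ [a]) ! i \<in> set xs"
      using that k by (simp add: nth_append)
    then have "?P ((xs @ [b, c, d]) @ [(xs @ [a]) ! i]) = 0"
      using k by (intro pfaffian_list_not_distinct) auto
    then show ?thesis by simp
  qed
  have g0: "?g i = 0" if "i < 2*k" for i
  proof -
    have "(xs @ [b, c, d]) ! i \<in> set xs"
      using that k by (simp add: nth_append)
    then have "?P ((xs @ [a]) @ [(xs @ [b, c, d]) ! i]) = 0"
      using k by (intro pfaffian_list_not_distinct) auto
    then show ?thesis by simp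
  qed
  have up: "{..2*k} = insert (2*k) {..<2*k}"
    "{..2*Suc k} = insert (2*k+2) (insert (2*k+1) (insert (2*k) {..<2*k}))"
    by auto
  have "(\<Sum>i\<le>2*k. ?f i) = ?f (2*k) + sum ?f {..<2*k}"
    unfolding up by (rule sum.insert) auto
  also have "sum ?f {..<2*k} = 0"
    by (rule sum.neutral) (use f0 in blast)
  also have "?f (2*k) + 0 = ?f (2*k)"
    by simp
  also have "\<dots> = ?P xs * ?P (xs @ [b, c, d, a])"
    using k by (simp add: nth_append list_update_append)
  \<comment> \<open>\<open>a\<close> passes three entries, an odd number.\<close>
  also have "?P (xs @ [b, c, d, a]) = - ?P (xs @ [a, b, c, d])"
    using pfaffian_list_move[of xs "[b, c, d]" "[]" M a] k by simp
  finally have f: "(\<Sum>i\<le>2*k. ?f i) = - (?P xs * ?P (xs @ [a, b, c, d]))"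
    by simp
  have "sum ?g {..<2*k} = 0"
    by (rule sum.neutral) (use g0 in blast)
  then have "(\<Sum>i\<le>2*Suc k. ?g i) = ?g (2*k+2) + ?g (2*k+1) + ?g (2*k)"
    unfolding up by (subst sum.insert, simp, simp)+ (simp only: add.assoc add_0_right)
  \<comment> \<open>Here \<open>b\<close> is removed and \<open>d\<close> put in its place, which
    produces the order \<open>d\<close>, \<open>c\<close>; restoring it accounts for the one product
    whose sign differs from that of its neighbour.\<close>
  also have "?g (2*k) = - ?P (xs @ [d, c]) * ?P (xs @ [a, b])"
    using k by (simp add: nth_append list_update_append butlast_append)
  also have "?g (2*k+1) = - ?P (xs @ [b, d]) * ?P (xs @ [a, c])"
    using k by (simp add: nth_append list_update_append butlast_append)
  also have "?g (2*k+2) = ?P (xs @ [b, c]) * ?P (xs @ [a, d])"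
    using k by (simp add: nth_append list_update_append butlast_append)
  also have "?P (xs @ [d, c]) = - ?P (xs @ [c, d])"
    using pfaffian_list_swap_adjacent[of xs "[]" M d c] k by simp
  finally have g: "(\<Sum>i\<le>2*Suc k. ?g i) = ?P (xs @ [b, c]) * ?P (xs @ [a, d])
      + - ?P (xs @ [b, d]) * ?P (xs @ [a, c]) + - (- ?P (xs @ [c, d])) * ?P (xs @ [a, b])" .
  have "(\<Sum>i\<le>2*k. ?f i) = - (\<Sum>i\<le>2*Suc k. ?g i)"
    using k by (intro pfaffian_list_exchange skew) auto
  then show ?thesis
    unfolding f g by (simp add: algebra_simps)
qed

section \<open>Schur polynomials of differential operators\<close>

lemma fps_deriv_tconst_exp:
  "fps_deriv (Abs_fps (\<lambda>j. tconst (1 / fact j))) = Abs_fps (\<lambda>j. tconst (1 / fact j))"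
proof (rule fps_ext)
  fix n
  have "of_nat (Suc n) * tconst (1 / fact (Suc n)) = tconst (of_nat (Suc n) * (1 / fact (Suc n)))"
    by (simp only: tconst_def single_of_nat[symmetric] mult_single add_0)
  also have "of_nat (Suc n) * (1 / fact (Suc n)) = (1 / fact n :: real)"
    by (simp add: field_simps del: of_nat_Suc)
  finally show "fps_nth (fps_deriv (Abs_fps (\<lambda>j. tconst (1 / fact j)))) n = fps_nth (Abs_fps (\<lambda>j. tconst (1 / fact j))) n"
    by simp
qed

lemma schur_0: "schur 0 = 1"
  by (simp add: schur_def tconst_def)

text \<open>Compare coefficients of z^n in (exp X)' = exp(X) X', where X is the series of the times.
  This avoids expanding the powers of X.\<close>

lemma schur_recursion:
  "of_nat (Suc n) * schur (int (Suc n)) =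
     (\<Sum>i\<le>n. of_nat (Suc (n - i)) * (tvar (Suc (n - i)) * schur (int i)))"
proof -
  define E where "E = Abs_fps (\<lambda>j. tconst (1 / fact j))"
  define X where "X = Abs_fps (\<lambda>l. if l = 0 then 0 else tvar l)"
  have schur: "schur (int k) = fps_nth (E oo X) k" for k
    by (simp add: schur_def E_def X_def)
  have "fps_deriv (E oo X) = (E oo X) * fps_deriv X"
    using fps_compose_deriv[of X E] fps_deriv_tconst_exp by (simp add: E_def X_def)
  then have "fps_nth (fps_deriv (E oo X)) n = fps_nth ((E oo X) * fps_deriv X) n"
    by simp
  then have "of_nat (Suc n) * schur (int (Suc n)) =
      (\<Sum>i\<le>n. schur (int i) * (of_nat (Suc (n - i)) * fps_nth X (Suc (n - i))))"
    unfolding fps_deriv_nth fps_mult_nth atLeast0AtMost schur by (simp only: Suc_eq_plus1)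
  then show ?thesis
    by (simp add: X_def mult_ac del: of_nat_Suc)
qed

section \<open>Substitution of operators into polynomials\<close>

lemma tpoly_induct [case_names zero single]:
  fixes P :: "tpoly \<Rightarrow> bool"
  assumes "P 0" and "\<And>a c p. P p \<Longrightarrow> P (Poly_Mapping.single a c + p)"
  shows "P p"
proof (induction p rule: update_induct)
  case (update p a c)
  have "Poly_Mapping.update a c p = Poly_Mapping.single a c + p"
    using update.hyps
    by (intro poly_mapping_eqI) (auto simp: lookup_update lookup_add lookup_single when_def in_keys_iff)
  then show ?case
    using assms(2) update by simp
qed (rule assms)

lemma subst_tpoly_0: "subst_tpoly D 0 f t = 0"
  by (simp add: subst_tpoly_def)

lemma subst_tpoly_add: "subst_tpoly D (p + q) f t = subst_tpoly D p f t + subst_tpoly D q f t"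
  unfolding subst_tpoly_def
  by (rule setsum_keys_plus_distrib[of "\<lambda>a c. c * subst_monom D a f t"]) (auto simp: algebra_simps)

lemma subst_tpoly_single: "subst_tpoly D (Poly_Mapping.single a c) f t = c * subst_monom D a f t"
  by (simp add: subst_tpoly_def)

lemma subst_tpoly_sum:
  "subst_tpoly D (sum p I) f t = (\<Sum>i\<in>I. subst_tpoly D (p i) f t)"
  by (induction I rule: infinite_finite_induct) (auto simp: subst_tpoly_0 subst_tpoly_add)

lemma subst_tpoly_of_nat_mult: "subst_tpoly D (of_nat k * p) f t = real k * subst_tpoly D p f t"
  by (induction k) (auto simp: subst_tpoly_0 subst_tpoly_add algebra_simps)

lemma subst_tpoly_1: "subst_tpoly D 1 f t = f t"
  by (simp add: subst_tpoly_def subst_monom_def lookup_one)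

text \<open>A variable that does not occur contributes a zeroth power, the identity. Monomials with
  different supports can thus be compared as compositions over one common interval of
  indices.\<close>

lemma subst_monom_eq_foldr:
  assumes "Poly_Mapping.keys a \<subseteq> {..<N}"
  shows "subst_monom D a = foldr (\<lambda>l F. (D l ^^ Poly_Mapping.lookup a l) \<circ> F) [0..<N] id"
proof -
  let ?g = "\<lambda>l F. (D l ^^ Poly_Mapping.lookup a l) \<circ> F"
  have fold: "foldr ?g xs id = foldr ?g (filter (\<lambda>l. l \<in> Poly_Mapping.keys a) xs) id" for xs
    by (induction xs) (auto simp: in_keys_iff)
  have "set (filter (\<lambda>l. l \<in> Poly_Mapping.keys a) [0..<N]) = Poly_Mapping.keys a"
    using assms by auto
  then have "sorted_list_of_set (Poly_Mapping.keys a) = filter (\<lambda>l. l \<in> Poly_Mapping.keys a) [0..<N]"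
    using sorted_list_of_set.idem_if_sorted_distinct[of "filter (\<lambda>l. l \<in> Poly_Mapping.keys a) [0..<N]"]
    by (simp add: sorted_wrt_filter)
  then show ?thesis
    unfolding subst_monom_def fold[of "[0..<N]"] by simp
qed

lemma pderiv_t_zero: "pderiv_t l (\<lambda>t. 0) t = 0"
  by (simp add: pderiv_t_def)

definition wderiv :: "nat \<Rightarrow> (times \<Rightarrow> real) \<Rightarrow> times \<Rightarrow> real" where
  "wderiv l f t = - (1 / real l) * pderiv_t l f t"

text \<open>The index \<open>l = 0\<close> needs no exclusion: \<open>1 / 0 = 0\<close> makes \<open>wderiv 0\<close> the zero operator.\<close>

lemma wderiv_0: "wderiv 0 f = (\<lambda>t. 0)"
  by (simp add: wderiv_def fun_eq_iff)

lemma wderiv_zero: "wderiv l (\<lambda>t. 0) = (\<lambda>t. 0)"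
  by (simp add: wderiv_def fun_eq_iff pderiv_t_zero)

lemma schur_op_eq: "schur_op k = subst_tpoly wderiv (schur k)"
  by (simp add: schur_op_def wderiv_def[abs_def])

lemma schur_op_0: "schur_op 0 f = f"
  by (simp add: schur_op_eq schur_0 subst_tpoly_1 fun_eq_iff)

lemma schur_op_neg: "k < 0 \<Longrightarrow> schur_op k f = (\<lambda>t. 0)"
  by (simp add: schur_op_eq schur_def subst_tpoly_0 fun_eq_iff)

section \<open>Index shifts and time derivatives\<close>

lemma sum_lessThan_double: "sum f {..<2*n} = (\<Sum>i<n. f (2*i) + f (2*i+1))"
  for f :: "nat \<Rightarrow> 'a::comm_monoid_add"
  by (induction n) (auto simp: add.assoc)

lemma alternating_telescope:
  fixes g :: "nat \<Rightarrow> real"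
  shows "(\<Sum>i\<le>n. (-1) ^ i * (g i + g (Suc i))) = g 0 + (-1) ^ n * g (Suc n)"
  by (induction n) (auto simp: algebra_simps)

lemma finite_subsets_card: "finite {S. S \<subseteq> {..<m::nat} \<and> card S = k}"
  by (rule finite_subset[of _ "Pow {..<m}"]) auto

text \<open>This encodes the squarefree monomial, the product of the shifts x_a for \<open>a\<close>
  in \<open>S\<close>, acting on the indices \<alpha>.\<close>

definition bump :: "nat set \<Rightarrow> (nat \<Rightarrow> nat) \<Rightarrow> nat \<Rightarrow> nat" where
  "bump S \<alpha> a = (if a \<in> S then Suc (\<alpha> a) else \<alpha> a)"

locale bimoment_flow =
  fixes mu :: "nat \<Rightarrow> nat \<Rightarrow> times \<Rightarrow> real" and U :: "times set"
  assumes open_U: "open_in_times U"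
    and smooth: "\<And>i j. smooth_in_times U (mu i j)"
    and evolution: "\<And>l i j t. l \<ge> 1 \<Longrightarrow> t \<in> U \<Longrightarrow>
          pderiv_t l (mu i j) t = mu (i + l) j t + mu i (j + l) t"
begin

section \<open>Differentiation of moments and Pfaffians\<close>

lemma mu_has_derivative:
  assumes "l \<ge> 1" "t \<in> U"
  shows "((\<lambda>x. mu i j (t(l := x))) has_field_derivative mu (i + l) j t + mu i (j + l) t) (at (t l))"
proof -
  \<comment> \<open>The evolution equation only fixes the value of \<open>deriv\<close>; that the
    derivative exists is the smoothness condition for the empty list of derivatives.\<close>
  have "(\<lambda>x. foldr pderiv_t [] (mu i j) (t(l := x))) field_differentiable at (t l)"
    using smooth[of i j] assms unfolding smooth_in_times_def
    by (metis empty_set empty_subsetI)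
  then have "((\<lambda>x. mu i j (t(l := x))) has_field_derivative deriv (\<lambda>x. mu i j (t(l := x))) (t l)) (at (t l))"
    by (simp add: field_differentiable_derivI)
  then show ?thesis
    using evolution[OF assms, of i j] by (simp add: pderiv_t_def)
qed

text \<open>Openness is given on slices of finitely many times. A partial derivative moves inside
  the slice of the single time \<open>l\<close>, and the line x \<mapsto> t(l := x) is continuous
  there.\<close>

lemma eventually_in_U:
  assumes "l \<ge> 1" "t \<in> U"
  shows "eventually (\<lambda>x. t(l := x) \<in> U) (nhds (t l))"
proof -
  have "openin (top_of_set (time_slice {l} t)) (U \<inter> time_slice {l} t)"
    using open_U assms(1) unfolding open_in_times_def by auto
  then obtain T where T: "open T" "U \<inter> time_slice {l} t = time_slice {l} t \<inter> T"
    by (auto simp: openin_open)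
  have slice: "t(l := x) \<in> time_slice {l} t" for x
    by (simp add: time_slice_def)
  have "continuous_on UNIV (\<lambda>x. t(l := x))"
  proof (rule continuous_on_coordinatewise_then_product)
    show "continuous_on UNIV (\<lambda>x. (t(l := x)) i)" for i
      by (cases "i = l") auto
  qed
  then have "open ((\<lambda>x. t(l := x)) -` T)"
    using T(1) by (simp add: continuous_on_open_vimage)
  moreover have "t l \<in> (\<lambda>x. t(l := x)) -` T"
    using T(2) slice[of "t l"] assms(2) by auto
  moreover have "t(l := x) \<in> U" if "x \<in> (\<lambda>x. t(l := x)) -` T" for x
    using T(2) slice[of x] that by auto
  ultimately show ?thesis
    unfolding eventually_nhds by blast
qed

text \<open>Equality on \<open>U\<close> suffices because the line in direction \<open>l\<close>
  stays in \<open>U\<close> near \<open>t\<close>. This permits differentiating identities that hold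
  on \<open>U\<close> only.\<close>

lemma pderiv_t_cong:
  assumes "\<And>t. t \<in> U \<Longrightarrow> f t = g t" "l \<ge> 1" "t \<in> U"
  shows "pderiv_t l f t = pderiv_t l g t"
  unfolding pderiv_t_def
  by (rule deriv_cong_ev[OF eventually_mono[OF eventually_in_U[OF assms(2,3)]]]) (auto intro: assms(1))

definition pf :: "nat \<Rightarrow> (nat \<Rightarrow> nat) \<Rightarrow> times \<Rightarrow> real" where
  "pf n \<alpha> t = pfaffian n (\<lambda>a b. mu (\<alpha> a) (\<alpha> b) t)"

lemma pfaffian_term_has_derivative:
  assumes p: "p permutes {..<2*n}" and lt: "l \<ge> 1" "t \<in> U"
  shows "((\<lambda>x. pfaffian_term n (\<lambda>a b. mu (\<alpha> a) (\<alpha> b) (t(l := x))) p) has_field_derivative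
    (\<Sum>c<2*n. pfaffian_term n (\<lambda>a b. mu ((\<alpha>(c := \<alpha> c + l)) a) ((\<alpha>(c := \<alpha> c + l)) b) t) p)) (at (t l))"
proof -
  let ?m = "\<lambda>i t. mu (\<alpha> (p (2*i))) (\<alpha> (p (2*i+1))) t"
  let ?d = "\<lambda>i. mu (\<alpha> (p (2*i)) + l) (\<alpha> (p (2*i+1))) t + mu (\<alpha> (p (2*i))) (\<alpha> (p (2*i+1)) + l) t"
  let ?T = "\<lambda>c. \<Prod>i<n. mu ((\<alpha>(c := \<alpha> c + l)) (p (2*i))) ((\<alpha>(c := \<alpha> c + l)) (p (2*i+1))) t"
  have inj: "p x = p y \<longleftrightarrow> x = y" for x y
    using permutes_inj[OF p] by (auto dest: injD)
  have "((\<lambda>x. \<Prod>i<n. ?m i (t(l := x))) has_field_derivative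
      (\<Sum>i<n. ?d i * (\<Prod>j\<in>{..<n}-{i}. ?m j (t(l := t l))))) (at (t l))"
    by (rule has_field_derivative_prod) (rule mu_has_derivative[OF lt])
  moreover have "(\<Sum>i<n. ?d i * (\<Prod>j\<in>{..<n}-{i}. ?m j (t(l := t l)))) =
      (\<Sum>i<n. ?T (p (2*i)) + ?T (p (2*i+1)))"
  proof (rule sum.cong[OF refl])
    fix i assume i: "i \<in> {..<n}"
    have rest: "(\<Prod>j\<in>{..<n}-{i}. mu ((\<alpha>(c := \<alpha> c + l)) (p (2*j))) ((\<alpha>(c := \<alpha> c + l)) (p (2*j+1))) t) =
                (\<Prod>j\<in>{..<n}-{i}. ?m j t)" if "c = p (2*i) \<or> c = p (2*i+1)" for c
      using that by (intro prod.cong refl) (auto simp: inj)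
    have "?T (p (2*i)) = mu (\<alpha> (p (2*i)) + l) (\<alpha> (p (2*i+1))) t * (\<Prod>j\<in>{..<n}-{i}. ?m j t)"
      using i rest by (subst prod.remove[of _ i]) (auto simp: inj)
    moreover have "?T (p (2*i+1)) = mu (\<alpha> (p (2*i))) (\<alpha> (p (2*i+1)) + l) t * (\<Prod>j\<in>{..<n}-{i}. ?m j t)"
      using i rest by (subst prod.remove[of _ i]) (auto simp: inj)
    ultimately show "?d i * (\<Prod>j\<in>{..<n}-{i}. ?m j (t(l := t l))) = ?T (p (2*i)) + ?T (p (2*i+1))"
      by (simp add: algebra_simps)
  qed
  moreover have "(\<Sum>i<n. ?T (p (2*i)) + ?T (p (2*i+1))) = (\<Sum>c<2*n. ?T (p c))"
    by (rule sum_lessThan_double[of "\<lambda>c. ?T (p c)" n, symmetric])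
  \<comment> \<open>The product rule runs over positions; since \<open>p\<close> is a bijection,
    this is a sum over the index that is raised, and that sum has the same form for every
    \<open>p\<close>.\<close>
  moreover have "(\<Sum>c<2*n. ?T (p c)) = (\<Sum>c<2*n. ?T c)"
    using sum.permute[OF p, of ?T] by (simp add: o_def)
  ultimately have "((\<lambda>x. \<Prod>i<n. ?m i (t(l := x))) has_field_derivative (\<Sum>c<2*n. ?T c)) (at (t l))"
    by simp
  then show ?thesis
    unfolding pfaffian_term_def sum_distrib_left[symmetric] by (rule DERIV_cmult)
qed

lemma pf_has_derivative:
  assumes "l \<ge> 1" "t \<in> U"
  shows "((\<lambda>x. pf n \<alpha> (t(l := x))) has_field_derivative (\<Sum>c<2*n. pf n (\<alpha>(c := \<alpha> c + l)) t)) (at (t l))"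
proof -
  let ?T = "\<lambda>c p. pfaffian_term n (\<lambda>a b. mu ((\<alpha>(c := \<alpha> c + l)) a) ((\<alpha>(c := \<alpha> c + l)) b) t) p"
  have "((\<lambda>x. (\<Sum>p | p permutes {..<2*n}. pfaffian_term n (\<lambda>a b. mu (\<alpha> a) (\<alpha> b) (t(l := x))) p) / (2^n * fact n))
      has_field_derivative (\<Sum>p | p permutes {..<2*n}. \<Sum>c<2*n. ?T c p) / (2^n * fact n)) (at (t l))"
    using assms by (intro DERIV_cdivide DERIV_sum pfaffian_term_has_derivative) auto
  moreover have "(\<Sum>p | p permutes {..<2*n}. \<Sum>c<2*n. ?T c p) / (2^n * fact n) =
      (\<Sum>c<2*n. pf n (\<alpha>(c := \<alpha> c + l)) t)"
    unfolding pf_def pfaffian_eq_sum_term sum_divide_distrib[symmetric]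
    by (subst sum.swap) (rule refl)
  ultimately show ?thesis
    unfolding pf_def pfaffian_eq_sum_term by (simp only:)
qed

lemma pderiv_t_pf:
  "l \<ge> 1 \<Longrightarrow> t \<in> U \<Longrightarrow> pderiv_t l (pf n \<alpha>) t = (\<Sum>c<2*n. pf n (\<alpha>(c := \<alpha> c + l)) t)"
  unfolding pderiv_t_def by (rule DERIV_imp_deriv[OF pf_has_derivative])

text \<open>
  Working in the linear span of Pfaffians, where everything is determined by the shifts of the
  indices, makes the partial derivatives commute without any appeal to Schwarz's theorem.
\<close>

inductive pf_span :: "nat \<Rightarrow> (times \<Rightarrow> real) \<Rightarrow> bool" for n where
  base: "pf_span n (pf n \<alpha>)"
| add: "pf_span n f \<Longrightarrow> pf_span n g \<Longrightarrow> pf_span n (\<lambda>t. f t + g t)"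
| scale: "pf_span n f \<Longrightarrow> pf_span n (\<lambda>t. c * f t)"
| eq_on: "pf_span n f \<Longrightarrow> (\<And>t. t \<in> U \<Longrightarrow> g t = f t) \<Longrightarrow> pf_span n g"

lemma pf_span_0: "pf_span n (\<lambda>t. 0)"
  using pf_span.scale[OF pf_span.base, of n 0] by simp

lemma pf_span_sum: "(\<And>i. i \<in> I \<Longrightarrow> pf_span n (f i)) \<Longrightarrow> pf_span n (\<lambda>t. \<Sum>i\<in>I. f i t)"
  by (induction I rule: infinite_finite_induct) (auto intro: pf_span_0 pf_span.add)

text \<open>\<open>deriv\<close> is total, so its linearity rests on differentiability, which the
  span inherits from the Pfaffians.\<close>

lemma pf_span_has_derivative:
  assumes "pf_span n f" "l \<ge> 1" "t \<in> U"
  shows "((\<lambda>x. f (t(l := x))) has_field_derivative pderiv_t l f t) (at (t l))"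
  using assms
proof (induction arbitrary: t)
  case (base \<alpha>)
  then show ?case
    by (simp only: pderiv_t_pf pf_has_derivative)
next
  case (add f g)
  show ?case
    unfolding pderiv_t_def
    by (rule field_differentiable_derivI, rule field_differentiable_add)
       (use add in \<open>auto simp: field_differentiable_def\<close>)
next
  case (scale f c)
  show ?case
    unfolding pderiv_t_def
    by (rule field_differentiable_derivI, rule field_differentiable_mult)
       (use scale in \<open>auto simp: field_differentiable_def\<close>)
next
  case (eq_on f g)
  have deriv: "pderiv_t l g t = pderiv_t l f t"
    using eq_on by (intro pderiv_t_cong) auto
  have ev: "eventually (\<lambda>x. g (t(l := x)) = f (t(l := x))) (nhds (t l))"
    using eq_on by (intro eventually_mono[OF eventually_in_U]) auto
  show ?case
    unfolding deriv
    by (rule DERIV_cong_ev[OF refl ev refl, THEN iffD2, OF eq_on.IH[OF eq_on.prems]])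
qed

lemma pderiv_t_add:
  assumes "pf_span n f" "pf_span n g" "l \<ge> 1" "t \<in> U"
  shows "pderiv_t l (\<lambda>t. f t + g t) t = pderiv_t l f t + pderiv_t l g t"
proof -
  have "((\<lambda>x. f (t(l := x)) + g (t(l := x))) has_field_derivative pderiv_t l f t + pderiv_t l g t) (at (t l))"
    using assms by (intro DERIV_add pf_span_has_derivative) auto
  then show ?thesis
    unfolding pderiv_t_def[of l "\<lambda>t. f t + g t"] by (rule DERIV_imp_deriv)
qed

lemma pderiv_t_scale:
  assumes "pf_span n f" "l \<ge> 1" "t \<in> U"
  shows "pderiv_t l (\<lambda>t. c * f t) t = c * pderiv_t l f t"
proof -
  have "((\<lambda>x. c * f (t(l := x))) has_field_derivative c * pderiv_t l f t) (at (t l))"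
    using assms by (intro DERIV_cmult pf_span_has_derivative) auto
  then show ?thesis
    unfolding pderiv_t_def[of l "\<lambda>t. c * f t"] by (rule DERIV_imp_deriv)
qed

lemma pderiv_t_sum:
  assumes "\<And>i. i \<in> I \<Longrightarrow> pf_span n (f i)" "l \<ge> 1" "t \<in> U"
  shows "pderiv_t l (\<lambda>t. \<Sum>i\<in>I. f i t) t = (\<Sum>i\<in>I. pderiv_t l (f i) t)"
  using assms
proof (induction I rule: infinite_finite_induct)
  case (insert i I)
  have "pderiv_t l (\<lambda>t. f i t + (\<Sum>i\<in>I. f i t)) t = pderiv_t l (f i) t + pderiv_t l (\<lambda>t. \<Sum>i\<in>I. f i t) t"
    using insert.prems by (intro pderiv_t_add[of n] pf_span_sum) auto
  then show ?case
    using insert by simp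
qed (simp_all add: pderiv_t_zero)

text \<open>The formulas for derivatives hold on \<open>U\<close>, while \<open>pderiv_t\<close> may
  take any values elsewhere; the rule \<open>eq_on\<close> of the span absorbs the
  difference.\<close>

lemma pf_span_pderiv_t:
  assumes "pf_span n f" "l \<ge> 1"
  shows "pf_span n (pderiv_t l f)"
  using assms
proof induction
  case (base \<alpha>)
  have "pf_span n (\<lambda>t. \<Sum>c<2*n. pf n (\<alpha>(c := \<alpha> c + l)) t)"
    by (rule pf_span_sum) (rule pf_span.base)
  then show ?case
    by (rule pf_span.eq_on) (rule pderiv_t_pf[OF base])
next
  case (add f g)
  have "pf_span n (\<lambda>t. pderiv_t l f t + pderiv_t l g t)"
    using add by (intro pf_span.add) auto
  then show ?case
    by (rule pf_span.eq_on) (rule pderiv_t_add[OF add.hyps add.prems])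
next
  case (scale f c)
  have "pf_span n (\<lambda>t. c * pderiv_t l f t)"
    using scale by (intro pf_span.scale) auto
  then show ?case
    by (rule pf_span.eq_on) (rule pderiv_t_scale[OF scale.hyps scale.prems])
next
  case (eq_on f g)
  show ?case
    by (rule pf_span.eq_on[OF eq_on.IH[OF eq_on.prems]], rule pderiv_t_cong[OF eq_on.hyps(2) eq_on.prems])
qed

lemma pderiv_t_commute:
  assumes "pf_span n f" "k \<ge> 1" "l \<ge> 1" "t \<in> U"
  shows "pderiv_t k (pderiv_t l f) t = pderiv_t l (pderiv_t k f) t"
  using assms
proof (induction arbitrary: t)
  case (base \<alpha>)
  have two: "pderiv_t k (pderiv_t l (pf n \<alpha>)) t =
      (\<Sum>c<2*n. \<Sum>d<2*n. pf n ((\<alpha>(c := \<alpha> c + l))(d := (\<alpha>(c := \<alpha> c + l)) d + k)) t)"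
    if "k \<ge> 1" "l \<ge> 1" for k l
  proof -
    have "pderiv_t k (pderiv_t l (pf n \<alpha>)) t = pderiv_t k (\<lambda>t. \<Sum>c<2*n. pf n (\<alpha>(c := \<alpha> c + l)) t) t"
      using that base by (intro pderiv_t_cong pderiv_t_pf) auto
    also have "\<dots> = (\<Sum>c<2*n. pderiv_t k (pf n (\<alpha>(c := \<alpha> c + l))) t)"
      using that base by (intro pderiv_t_sum[of _ n]) (auto intro: pf_span.base)
    finally show ?thesis
      using that base by (simp add: pderiv_t_pf del: fun_upd_apply)
  qed
  \<comment> \<open>For c = d both orders raise the index by k + l.\<close>
  have comm: "(\<alpha>(c := \<alpha> c + l))(d := (\<alpha>(c := \<alpha> c + l)) d + k) =
        (\<alpha>(d := \<alpha> d + k))(c := (\<alpha>(d := \<alpha> d + k)) c + l)" for c d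
    by auto
  show ?case
    unfolding two[OF base(1,2)] two[OF base(2,1)]
    by (subst sum.swap) (intro sum.cong refl, subst comm, rule refl)
next
  case (add f g)
  have "pderiv_t k (pderiv_t l (\<lambda>t. f t + g t)) t = pderiv_t k (pderiv_t l f) t + pderiv_t k (pderiv_t l g) t"
    if "k \<ge> 1" "l \<ge> 1" for k l
  proof -
    have "pderiv_t k (pderiv_t l (\<lambda>t. f t + g t)) t = pderiv_t k (\<lambda>t. pderiv_t l f t + pderiv_t l g t) t"
      using that add by (intro pderiv_t_cong pderiv_t_add[of n]) auto
    then show ?thesis
      using that add by (simp add: pderiv_t_add[of n] pf_span_pderiv_t)
  qed
  then show ?case
    using add by simp
next
  case (scale f c)
  have "pderiv_t k (pderiv_t l (\<lambda>t. c * f t)) t = c * pderiv_t k (pderiv_t l f) t"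
    if "k \<ge> 1" "l \<ge> 1" for k l
  proof -
    have "pderiv_t k (pderiv_t l (\<lambda>t. c * f t)) t = pderiv_t k (\<lambda>t. c * pderiv_t l f t) t"
      using that scale by (intro pderiv_t_cong pderiv_t_scale[of n]) auto
    then show ?thesis
      using that scale by (simp add: pderiv_t_scale[of n] pf_span_pderiv_t)
  qed
  then show ?case
    using scale by simp
next
  case (eq_on f g)
  have "pderiv_t k (pderiv_t l g) t = pderiv_t k (pderiv_t l f) t" if "k \<ge> 1" "l \<ge> 1" for k l
    using that eq_on by (intro pderiv_t_cong) auto
  then show ?case
    using eq_on by simp
qed

section \<open>Weighted derivatives and their polynomials on the span\<close>

lemma pf_span_wderiv: "pf_span n f \<Longrightarrow> pf_span n (wderiv l f)"
  using pf_span.scale[OF pf_span_pderiv_t, of n f l "- (1 / real l)"]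
  by (cases "l = 0") (simp_all add: wderiv_0 pf_span_0 wderiv_def[abs_def])

lemma wderiv_cong:
  assumes "\<And>t. t \<in> U \<Longrightarrow> f t = g t" "t \<in> U"
  shows "wderiv l f t = wderiv l g t"
  using pderiv_t_cong[of f g l t] assms by (cases "l = 0") (auto simp: wderiv_def)

lemma wderiv_add:
  assumes "pf_span n f" "pf_span n g" "t \<in> U"
  shows "wderiv l (\<lambda>t. f t + g t) t = wderiv l f t + wderiv l g t"
  using pderiv_t_add[of n f g l t] assms by (cases "l = 0") (auto simp: wderiv_def algebra_simps add_divide_distrib)

lemma wderiv_scale:
  assumes "pf_span n f" "t \<in> U"
  shows "wderiv l (\<lambda>t. c * f t) t = c * wderiv l f t"
  using pderiv_t_scale[of n f l t c] assms by (cases "l = 0") (auto simp: wderiv_def)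

lemma wderiv_commute:
  assumes "pf_span n f" "t \<in> U"
  shows "wderiv k (wderiv l f) t = wderiv l (wderiv k f) t"
proof (cases "k = 0 \<or> l = 0")
  case True
  then show ?thesis
    by (auto simp: wderiv_0 wderiv_zero)
next
  case False
  have "wderiv k (wderiv l f) t = (1 / real k) * (1 / real l) * pderiv_t k (pderiv_t l f) t"
    if "k \<ge> 1" "l \<ge> 1" for k l
    unfolding wderiv_def
    using that assms pderiv_t_scale[of n "pderiv_t l f" k t "- (1 / real l)"] pf_span_pderiv_t
    by simp
  then show ?thesis
    using False assms pderiv_t_commute[of n f k l t] by simp
qed

lemma pf_span_wderiv_pow: "pf_span n f \<Longrightarrow> pf_span n ((wderiv l ^^ k) f)"
  by (induction k) (auto intro: pf_span_wderiv)

lemma wderiv_pow_cong: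
  assumes "\<And>t. t \<in> U \<Longrightarrow> f t = g t" "t \<in> U"
  shows "(wderiv l ^^ k) f t = (wderiv l ^^ k) g t"
  using assms(2) by (induction k arbitrary: t) (auto intro: assms(1) wderiv_cong)

lemma wderiv_pow_commute:
  assumes "pf_span n f" "t \<in> U"
  shows "(wderiv k ^^ j) (wderiv l f) t = wderiv l ((wderiv k ^^ j) f) t"
  using assms(2)
proof (induction j arbitrary: t)
  case (Suc j)
  have "(wderiv k ^^ Suc j) (wderiv l f) t = wderiv k (wderiv l ((wderiv k ^^ j) f)) t"
    using Suc by (auto intro: wderiv_cong)
  also have "\<dots> = wderiv l ((wderiv k ^^ Suc j) f) t"
    using wderiv_commute[of n "(wderiv k ^^ j) f"] pf_span_wderiv_pow assms Suc.prems by simp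
  finally show ?case .
qed simp

lemma pf_span_foldr_wderiv:
  "pf_span n f \<Longrightarrow> pf_span n (foldr (\<lambda>l F. (wderiv l ^^ e l) \<circ> F) xs id f)"
  by (induction xs) (auto intro: pf_span_wderiv_pow)

text \<open>The additional operator \<open>wderiv l\<close> sits in the middle of the composition,
  at the place of \<open>l\<close>. It is commuted outwards past the powers that precede it in the
  list.\<close>

lemma foldr_wderiv_Suc:
  assumes e': "e' l = Suc (e l)" "\<And>k. k \<noteq> l \<Longrightarrow> e' k = e k" and f: "pf_span n f"
  shows "distinct xs \<Longrightarrow> l \<in> set xs \<Longrightarrow> t \<in> U \<Longrightarrow>
    foldr (\<lambda>k F. (wderiv k ^^ e' k) \<circ> F) xs id f t = wderiv l (foldr (\<lambda>k F. (wderiv k ^^ e k) \<circ> F) xs id f) t"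
proof (induction xs arbitrary: t)
  case (Cons x xs)
  let ?F = "\<lambda>e xs. foldr (\<lambda>k F. (wderiv k ^^ e k) \<circ> F) xs id f"
  show ?case
  proof (cases "x = l")
    case True
    then have "e' k = e k" if "k \<in> set xs" for k
      using that Cons.prems(1) by (intro e'(2)) auto
    then have "foldr (\<lambda>k F. (wderiv k ^^ e' k) \<circ> F) xs id = foldr (\<lambda>k F. (wderiv k ^^ e k) \<circ> F) xs id"
      by (intro foldr_cong refl) simp
    then have eq: "?F e' xs = ?F e xs"
      by (rule fun_cong)
    have "?F e' (x # xs) t = wderiv l ((wderiv l ^^ e l) (?F e' xs)) t"
      using True e'(1) by simp
    also have "\<dots> = wderiv l (?F e (x # xs)) t"
      unfolding eq using True by simp
    finally show ?thesis .
  next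
    case False
    then have "?F e' (x # xs) t = (wderiv x ^^ e x) (?F e' xs) t"
      using e'(2) by simp
    also have "\<dots> = (wderiv x ^^ e x) (wderiv l (?F e xs)) t"
      using Cons.prems False by (intro wderiv_pow_cong Cons.IH) auto
    also have "\<dots> = wderiv l (?F e (x # xs)) t"
      using wderiv_pow_commute[OF pf_span_foldr_wderiv[OF f] Cons.prems(3)] by simp
    finally show ?thesis .
  qed
qed simp

lemma pf_span_subst_monom: "pf_span n f \<Longrightarrow> pf_span n (subst_monom wderiv a f)"
  unfolding subst_monom_def by (rule pf_span_foldr_wderiv)

lemma subst_monom_single_add:
  assumes "pf_span n f" "t \<in> U"
  shows "subst_monom wderiv (Poly_Mapping.single l 1 + a) f t = wderiv l (subst_monom wderiv a f) t"
proof -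
  obtain N where N: "insert l (Poly_Mapping.keys a) \<subseteq> {..<N}"
    using finite_nat_bounded[of "insert l (Poly_Mapping.keys a)"] by auto
  then have keys: "Poly_Mapping.keys a \<subseteq> {..<N}" "Poly_Mapping.keys (Poly_Mapping.single l 1 + a) \<subseteq> {..<N}"
    using keys_add[of "Poly_Mapping.single l (1::nat)" a] by auto
  show ?thesis
    unfolding keys[THEN subst_monom_eq_foldr]
    by (rule foldr_wderiv_Suc[OF _ _ assms(1)])
       (use assms(2) N in \<open>auto simp: lookup_add lookup_single when_def\<close>)
qed

lemma pf_span_subst_tpoly: "pf_span n f \<Longrightarrow> pf_span n (subst_tpoly wderiv p f)"
  unfolding subst_tpoly_def by (intro pf_span_sum pf_span.scale pf_span_subst_monom)

text \<open>This is the multiplicativity of the substitution for a factor t_l, the form in which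
  products occur in \<open>schur_recursion\<close>.\<close>

lemma subst_tpoly_tvar_mult:
  assumes "pf_span n f" "t \<in> U"
  shows "subst_tpoly wderiv (tvar l * p) f t = wderiv l (subst_tpoly wderiv p f) t"
  using assms(2)
proof (induction p arbitrary: t rule: tpoly_induct)
  case zero
  have "subst_tpoly wderiv 0 f = (\<lambda>t. 0)"
    by (simp add: fun_eq_iff subst_tpoly_0)
  then show ?case
    by (simp add: subst_tpoly_0 wderiv_zero)
next
  case (single a c p)
  have "subst_tpoly wderiv (tvar l * (Poly_Mapping.single a c + p)) f t =
      subst_tpoly wderiv (Poly_Mapping.single (Poly_Mapping.single l 1 + a) c) f t +
      subst_tpoly wderiv (tvar l * p) f t"
    by (simp add: distrib_left subst_tpoly_add tvar_def mult_single)
  also have "\<dots> = c * wderiv l (subst_monom wderiv a f) t + wderiv l (subst_tpoly wderiv p f) t"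
    using single assms(1) by (simp only: subst_tpoly_single subst_monom_single_add)
  also have "\<dots> = wderiv l (\<lambda>t. c * subst_monom wderiv a f t + subst_tpoly wderiv p f t) t"
    using single.prems assms(1)
    by (simp add: wderiv_add[of n] wderiv_scale[of n] pf_span.scale pf_span_subst_monom pf_span_subst_tpoly)
  also have "(\<lambda>t. c * subst_monom wderiv a f t + subst_tpoly wderiv p f t) =
      subst_tpoly wderiv (Poly_Mapping.single a c + p) f"
    by (simp add: fun_eq_iff subst_tpoly_add subst_tpoly_single)
  finally show ?case .
qed

lemma schur_op_recursion:
  assumes "pf_span n f" "t \<in> U"
  shows "real (Suc k) * schur_op (int (Suc k)) f t =
    - (\<Sum>i\<le>k. pderiv_t (Suc (k - i)) (schur_op (int i) f) t)"
proof -
  have "real (Suc k) * schur_op (int (Suc k)) f t =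
      subst_tpoly wderiv (of_nat (Suc k) * schur (int (Suc k))) f t"
    unfolding subst_tpoly_of_nat_mult schur_op_eq ..
  also have "\<dots> = (\<Sum>i\<le>k. real (Suc (k - i)) * wderiv (Suc (k - i)) (schur_op (int i) f) t)"
    unfolding schur_recursion subst_tpoly_sum subst_tpoly_of_nat_mult schur_op_eq
    using assms by (simp only: subst_tpoly_tvar_mult)
  \<comment> \<open>The factor l = k - i + 1 from the recursion cancels the weight 1/l of the
    derivative.\<close>
  also have "\<dots> = (\<Sum>i\<le>k. - pderiv_t (Suc (k - i)) (schur_op (int i) f) t)"
    by (intro sum.cong refl) (simp add: wderiv_def del: of_nat_Suc)
  finally show ?thesis
    by (simp only: sum_negf)
qed

text \<open>
  \<open>pf_elem\<close> and \<open>pf_hook\<close> are the elementary and the hook Schur polynomials in the commuting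
  index shifts, so that \<open>schur_op_pf\<close> is Newton's identity in telescoped form.
\<close>

definition pf_elem :: "nat \<Rightarrow> (nat \<Rightarrow> nat) \<Rightarrow> nat \<Rightarrow> times \<Rightarrow> real" where
  "pf_elem n \<alpha> k t = (\<Sum>S | S \<subseteq> {..<2*n} \<and> card S = k. pf n (bump S \<alpha>) t)"

definition pf_hook :: "nat \<Rightarrow> (nat \<Rightarrow> nat) \<Rightarrow> nat \<Rightarrow> nat \<Rightarrow> times \<Rightarrow> real" where
  "pf_hook n \<alpha> l k t = (\<Sum>S | S \<subseteq> {..<2*n} \<and> card S = k.
     \<Sum>c\<in>S. pf n ((bump (S - {c}) \<alpha>)(c := \<alpha> c + l)) t)"

lemma pf_span_pf_elem: "pf_span n (pf_elem n \<alpha> k)"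
  unfolding pf_elem_def[abs_def] by (intro pf_span_sum pf_span.base)

lemma pf_hook_0: "pf_hook n \<alpha> l 0 t = 0"
  unfolding pf_hook_def
proof (rule sum.neutral, rule ballI)
  fix S assume "S \<in> {S. S \<subseteq> {..<2*n} \<and> card S = 0}"
  then have "S = {}"
    using finite_subset[of S "{..<2*n}"] by auto
  then show "(\<Sum>c\<in>S. pf n ((bump (S - {c}) \<alpha>)(c := \<alpha> c + l)) t) = 0"
    by simp
qed

text \<open>For l = 1 the distinguished position is raised like the others, so each set
  \<open>S\<close> is counted once for each of its k elements.\<close>

lemma pf_hook_1: "pf_hook n \<alpha> 1 k t = real k * pf_elem n \<alpha> k t"
proof -
  have "(bump (S - {c}) \<alpha>)(c := \<alpha> c + 1) = bump S \<alpha>" if "c \<in> S" for S :: "nat set" and c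
    using that by (auto simp: bump_def fun_eq_iff)
  then show ?thesis
    by (auto simp: pf_hook_def pf_elem_def sum_distrib_left intro!: sum.cong)
qed

text \<open>In the product of the power sum and the elementary polynomial, the position
  \<open>c\<close> raised by l either lies in \<open>S\<close> already, giving a total raise of l +
  1, or lies outside and enlarges \<open>S\<close> as its distinguished element.\<close>

lemma pderiv_t_pf_elem:
  assumes l: "l \<ge> 1" and t: "t \<in> U"
  shows "pderiv_t l (pf_elem n \<alpha> k) t = pf_hook n \<alpha> (Suc l) k t + pf_hook n \<alpha> l (Suc k) t"
proof -
  let ?S = "\<lambda>k. {S. S \<subseteq> {..<2*n} \<and> card S = k}"
  let ?p = "\<lambda>S c. pf n ((bump S \<alpha>)(c := bump S \<alpha> c + l)) t"
  have fin: "finite S" if "S \<in> ?S k" for S k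
    using that finite_subset[of S "{..<2*n}"] by auto
  have "pderiv_t l (pf_elem n \<alpha> k) t = (\<Sum>S\<in>?S k. pderiv_t l (pf n (bump S \<alpha>)) t)"
    unfolding pf_elem_def using l t by (intro pderiv_t_sum[of _ n] pf_span.base)
  also have "\<dots> = (\<Sum>S\<in>?S k. \<Sum>c<2*n. ?p S c)"
    unfolding pderiv_t_pf[OF l t] ..
  also have "\<dots> = (\<Sum>S\<in>?S k. (\<Sum>c\<in>S. ?p S c) + (\<Sum>c\<in>{..<2*n}-S. ?p S c))"
    by (intro sum.cong refl, subst sum.subset_diff) (auto simp: add.commute)
  also have "\<dots> = (\<Sum>S\<in>?S k. \<Sum>c\<in>S. ?p S c) + (\<Sum>S\<in>?S k. \<Sum>c\<in>{..<2*n}-S. ?p S c)"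
    by (rule sum.distrib)
  also have "(\<Sum>S\<in>?S k. \<Sum>c\<in>S. ?p S c) = pf_hook n \<alpha> (Suc l) k t"
    unfolding pf_hook_def
  proof (intro sum.cong refl)
    fix S :: "nat set" and c assume "c \<in> S"
    then have "(bump S \<alpha>)(c := bump S \<alpha> c + l) = (bump (S - {c}) \<alpha>)(c := \<alpha> c + Suc l)"
      by (auto simp: bump_def fun_eq_iff)
    then show "?p S c = pf n ((bump (S - {c}) \<alpha>)(c := \<alpha> c + Suc l)) t"
      by simp
  qed
  also have "(\<Sum>S\<in>?S k. \<Sum>c\<in>{..<2*n}-S. ?p S c) =
      (\<Sum>(S, c)\<in>Sigma (?S k) (\<lambda>S. {..<2*n} - S). ?p S c)"
    by (rule sum.Sigma) (auto simp: finite_subsets_card)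
  also have "\<dots> = (\<Sum>(S, c)\<in>Sigma (?S (Suc k)) (\<lambda>S. S). pf n ((bump (S - {c}) \<alpha>)(c := \<alpha> c + l)) t)"
  proof (rule sum.reindex_bij_witness[of _ "\<lambda>(S, c). (S - {c}, c)" "\<lambda>(S, c). (insert c S, c)"])
    fix x assume "x \<in> Sigma (?S k) (\<lambda>S. {..<2*n} - S)"
    then obtain S c where x: "x = (S, c)" "S \<in> ?S k" "c < 2*n" "c \<notin> S"
      by auto
    then show "(case case x of (S, c) \<Rightarrow> (insert c S, c) of (S, c) \<Rightarrow> (S - {c}, c)) = x"
      by simp
    show "(case x of (S, c) \<Rightarrow> (insert c S, c)) \<in> Sigma (?S (Suc k)) (\<lambda>S. S)"
      using x fin[OF x(2)] by simp
    show "(case case x of (S, c) \<Rightarrow> (insert c S, c) of (S, c) \<Rightarrow>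
             pf n ((bump (S - {c}) \<alpha>)(c := \<alpha> c + l)) t) = (case x of (S, c) \<Rightarrow> ?p S c)"
      using x by (simp add: bump_def)
  next
    fix x assume "x \<in> Sigma (?S (Suc k)) (\<lambda>S. S)"
    then obtain S c where x: "x = (S, c)" "S \<in> ?S (Suc k)" "c \<in> S"
      by auto
    then show "(case case x of (S, c) \<Rightarrow> (S - {c}, c) of (S, c) \<Rightarrow> (insert c S, c)) = x"
      by auto
    show "(case x of (S, c) \<Rightarrow> (S - {c}, c)) \<in> Sigma (?S k) (\<lambda>S. {..<2*n} - S)"
      using x fin[OF x(2)] by auto
  qed
  also have "\<dots> = pf_hook n \<alpha> l (Suc k) t"
    unfolding pf_hook_def by (rule sum.Sigma[symmetric]) (auto simp: finite_subsets_card intro: fin)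
  finally show ?thesis .
qed

lemma schur_op_pf:
  assumes "t \<in> U"
  shows "schur_op (int k) (pf n \<alpha>) t = (-1) ^ k * pf_elem n \<alpha> k t"
  using assms
proof (induction k arbitrary: t rule: less_induct)
  case (less k)
  show ?case
  proof (cases k)
    case 0
    have "{S. S \<subseteq> {..<2*n} \<and> card S = 0} = {{}}"
      by (auto simp: card_eq_0_iff dest: finite_subset)
    moreover have "bump {} \<alpha> = \<alpha>"
      by (simp add: bump_def fun_eq_iff)
    ultimately show ?thesis
      using 0 by (simp add: schur_op_0 pf_elem_def)
  next
    case (Suc j)
    \<comment> \<open>Total degree j + 2 - i + (i - 1) = k for i \<ge> 1: the derivative in time j +
      1 - i of the elementary sum of degree i is \<open>?g i + ?g (Suc i)\<close>. With alternating
      signs only the ends survive: \<open>?g 0\<close> is 0 and \<open>?g (Suc j)\<close> is k times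
      the elementary sum of degree k.\<close>
    let ?g = "\<lambda>i. pf_hook n \<alpha> (Suc (Suc j) - i) i t"
    have step: "pderiv_t (Suc (j - i)) (schur_op (int i) (pf n \<alpha>)) t = (-1) ^ i * (?g i + ?g (Suc i))"
      if "i \<le> j" for i
    proof -
      have "pderiv_t (Suc (j - i)) (schur_op (int i) (pf n \<alpha>)) t =
          pderiv_t (Suc (j - i)) (\<lambda>t. (-1) ^ i * pf_elem n \<alpha> i t) t"
        using less Suc that by (intro pderiv_t_cong) auto
      also have "\<dots> = (-1) ^ i * pderiv_t (Suc (j - i)) (pf_elem n \<alpha> i) t"
        using less.prems by (intro pderiv_t_scale[of n] pf_span_pf_elem) auto
      finally show ?thesis
        using that less.prems by (simp add: pderiv_t_pf_elem Suc_diff_le)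
    qed
    have "real k * schur_op (int k) (pf n \<alpha>) t = - (\<Sum>i\<le>j. (-1) ^ i * (?g i + ?g (Suc i)))"
      unfolding Suc schur_op_recursion[OF pf_span.base less.prems] 
      by (intro arg_cong[of _ _ uminus] sum.cong refl step) simp
    also have "\<dots> = - ((-1) ^ j * pf_hook n \<alpha> 1 k t)"
      using alternating_telescope[of ?g j] by (simp add: pf_hook_0 Suc)
    also have "\<dots> = real k * ((-1) ^ k * pf_elem n \<alpha> k t)"
      unfolding pf_hook_1 by (simp add: Suc)
    finally have "real k * schur_op (int k) (pf n \<alpha>) t = real k * ((-1) ^ k * pf_elem n \<alpha> k t)" .
    moreover have "real k \<noteq> 0"
      using Suc by simp
    ultimately show ?thesis
      by (metis mult_left_cancel)
  qed
qed

end

section \<open>The bilinear identities\<close>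

lemma final_segment_card:
  fixes S :: "nat set"
  assumes S: "S \<subseteq> {..<m}" and up: "\<And>c. c \<in> S \<Longrightarrow> Suc c < m \<Longrightarrow> Suc c \<in> S"
  shows "S = {m - card S..<m}"
proof (cases "S = {}")
  case False
  define a where "a = Min S"
  have fin: "finite S"
    using S finite_subset by blast
  then have a: "a \<in> S" "\<And>x. x \<in> S \<Longrightarrow> a \<le> x"
    using False by (auto simp: a_def)
  have "c < m \<longrightarrow> c \<in> S" if "a \<le> c" for c
    using that by (induction c rule: dec_induct) (use a up in auto)
  then have eq: "S = {a..<m}"
    using S a by auto
  moreover have "a < m"
    using a S by auto
  ultimately have "m - card S = a"
    by simp
  with eq show ?thesis
    by simp
qed simp

text \<open>These are consecutive indices from \<open>m\<close> on with \<open>p\<close> omitted. A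
  gap just past the end, p = m + 2n, leaves the plain run of \<tau>, so one family covers \<tau> and
  its images.\<close>

definition skip :: "nat \<Rightarrow> nat \<Rightarrow> nat \<Rightarrow> nat" where
  "skip m p a = (if m + a < p then m + a else Suc (m + a))"

lemma map_skip:
  assumes "m \<le> p" "p \<le> m + k"
  shows "map (skip m p) [0..<k] = [m..<p] @ [Suc p..<Suc (m + k)]"
  using assms by (intro nth_equalityI) (auto simp: skip_def nth_append)

lemma pfaffian_tau_list:
  "tau mu (int n) m t = pfaffian_list (\<lambda>i j. mu i j t) [m..<m + 2*n]"
proof -
  have "[m..<m + 2*n] = map ((+) m) [0..<2*n]"
    by (intro nth_equalityI) auto
  then show ?thesis
    by (simp only: pfaffian_list_map) (simp add: tau_def)
qed

locale skew_bimoment_flow = bimoment_flow +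
  assumes skew: "\<And>i j t. t \<in> U \<Longrightarrow> mu i j t = - mu j i t"
begin

abbreviation pfl :: "times \<Rightarrow> nat list \<Rightarrow> real" where
  "pfl t \<equiv> pfaffian_list (\<lambda>i j. mu i j t)"

lemma pf_eq_list: "pf n \<alpha> t = pfl t (map \<alpha> [0..<2*n])"
  by (simp add: pf_def pfaffian_list_map)

lemma tau_eq_pf: "tau mu (int n) m = pf n (skip m (m + 2*n))"
  by (auto simp: fun_eq_iff tau_def pf_def skip_def intro!: pfaffian_cong)

lemma pf_repeated:
  "i < 2*n \<Longrightarrow> j < 2*n \<Longrightarrow> i \<noteq> j \<Longrightarrow> \<alpha> i = \<alpha> j \<Longrightarrow> pf n \<alpha> t = 0"
  unfolding pf_def by (rule pfaffian_repeated_index[of i n j \<alpha> "\<lambda>i j. mu i j t"])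

text \<open>A raised position followed by one that is not raised produces a repeated index, so
  \<open>S\<close> must be a final segment. Raising the last k indices moves the gap from m + 2n
  down to m + 2n - k.\<close>

lemma pf_elem_skip:
  assumes "k \<le> 2*n"
  shows "pf_elem n (skip m (m + 2*n)) k t = pf n (skip m (m + 2*n - k)) t"
proof -
  let ?\<alpha> = "skip m (m + 2*n)" and ?T = "{2*n - k..<2*n}"
  have "pf n (bump S ?\<alpha>) t = 0" if S: "S \<subseteq> {..<2*n}" "card S = k" "S \<noteq> ?T" for S
  proof -
    obtain c where "c \<in> S" "Suc c < 2*n" "Suc c \<notin> S"
      using final_segment_card[OF S(1)] S by auto
    then show ?thesis
      by (intro pf_repeated[of c n "Suc c"]) (auto simp: bump_def skip_def)
  qed
  then have "pf_elem n ?\<alpha> k t = (\<Sum>S\<in>{?T}. pf n (bump S ?\<alpha>) t)"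
    unfolding pf_elem_def using assms
    by (intro sum.mono_neutral_right finite_subsets_card) auto
  also have "\<dots> = pf n (skip m (m + 2*n - k)) t"
    using assms unfolding pf_def by (auto intro!: pfaffian_cong simp: bump_def skip_def)
  finally show ?thesis .
qed

lemma pf_elem_eq_0:
  assumes "k > 2*n"
  shows "pf_elem n \<alpha> k t = 0"
proof -
  have "card S \<noteq> k" if "S \<subseteq> {..<2*n}" for S
    using card_mono[OF _ that] assms by simp
  then have "{S. S \<subseteq> {..<2*n} \<and> card S = k} = {}"
    by blast
  then show ?thesis
    unfolding pf_elem_def by (simp only: sum.empty)
qed

lemma schur_op_tau:
  assumes "t \<in> U" "m \<le> p" "p \<le> m + 2*n"
  shows "schur_op (int (m + 2*n - p)) (tau mu (int n) m) t = (-1) ^ (m + 2*n - p) * pf n (skip m p) t"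
proof -
  have "m + 2*n - (m + 2*n - p) = p"
    using assms by simp
  then show ?thesis
    unfolding tau_eq_pf schur_op_pf[OF assms(1)] using assms pf_elem_skip[of "m + 2*n - p" n m t] by simp
qed

lemma schur_op_tau_list:
  assumes "t \<in> U" "m \<le> p" "p \<le> m + 2*n"
  shows "schur_op (int (m + 2*n - p)) (tau mu (int n) m) t =
    (-1) ^ (m + 2*n - p) * pfl t ([m..<p] @ [Suc p..<Suc (m + 2*n)])"
  unfolding schur_op_tau[OF assms] pf_eq_list map_skip[OF assms(2,3)] ..

lemma schur_op_tau_eq_0: "t \<in> U \<Longrightarrow> k > 2*n \<Longrightarrow> schur_op (int k) (tau mu (int n) m) t = 0"
  by (simp add: tau_eq_pf schur_op_pf pf_elem_eq_0)

lemma schur_op_1_tau: "t \<in> U \<Longrightarrow> schur_op 1 (tau mu (int n) m) t = - pderiv_t 1 (tau mu (int n) m) t"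
  using schur_op_recursion[OF pf_span.base, of t 0] by (simp add: tau_eq_pf schur_op_0)

text \<open>This is the case k = 1 of the gap formula, since s_1 of the negated derivatives is
  -d/dt_1; for n \<ge> 1 the gap does not lie below \<open>m\<close>.\<close>

lemma pderiv_t_1_tau:
  assumes "t \<in> U" "n \<ge> 1"
  shows "pderiv_t 1 (tau mu (int n) m) t = pfl t ([m..<m + 2*n - 1] @ [m + 2*n])"
  using schur_op_1_tau[OF assms(1), of n m] schur_op_tau_list[OF assms(1), of m "m + 2*n - 1" n] assms(2)
  by simp

lemma pderiv_t_1_pf_skip:
  assumes t: "t \<in> U" and p: "m < p" "p < m + 2*n"
  shows "pderiv_t 1 (pf n (skip m p)) t =
    pf n (skip m (p - 1)) t + pfl t ([m..<p] @ [Suc p..<m + 2*n] @ [Suc (m + 2*n)])"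
proof -
  \<comment> \<open>\<open>?c\<close> is the position of p - 1, just below the gap, and
    \<open>?d\<close> the last position, with index m + 2n. Any other index collides with its
    successor when raised by one.\<close>
  let ?\<alpha> = "skip m p" and ?c = "p - m - 1" and ?d = "2*n - 1"
  have "pf n (?\<alpha>(c := ?\<alpha> c + 1)) t = 0" if "c < 2*n" "c \<noteq> ?c" "c \<noteq> ?d" for c
    using that p by (intro pf_repeated[of c n "Suc c"]) (auto simp: skip_def)
  then have "(\<Sum>c<2*n. pf n (?\<alpha>(c := ?\<alpha> c + 1)) t) = (\<Sum>c\<in>{?c, ?d}. pf n (?\<alpha>(c := ?\<alpha> c + 1)) t)"
    using p by (intro sum.mono_neutral_right) auto
  also have "\<dots> = pf n (?\<alpha>(?c := ?\<alpha> ?c + 1)) t + pf n (?\<alpha>(?d := ?\<alpha> ?d + 1)) t"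
    using p by (subst sum.insert) auto
  also have "?\<alpha>(?c := ?\<alpha> ?c + 1) = skip m (p - 1)"
    using p by (auto simp: skip_def fun_eq_iff)
  also have "map (?\<alpha>(?d := ?\<alpha> ?d + 1)) [0..<2*n] = [m..<p] @ [Suc p..<m + 2*n] @ [Suc (m + 2*n)]"
    using p by (intro nth_equalityI) (auto simp: skip_def nth_append nth_Cons')
  then have "pf n (?\<alpha>(?d := ?\<alpha> ?d + 1)) t = pfl t ([m..<p] @ [Suc p..<m + 2*n] @ [Suc (m + 2*n)])"
    by (simp only: pf_eq_list)
  finally show ?thesis
    unfolding pderiv_t_pf[OF order_refl t] .
qed

lemma pderiv_t_1_schur_op_tau:
  assumes t: "t \<in> U" and p: "m < p" "p < m + 2*n"
  shows "pderiv_t 1 (schur_op (int (m + 2*n - p)) (tau mu (int n) m)) t =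
    (-1) ^ (m + 2*n - p) * (pf n (skip m (p - 1)) t + pfl t ([m..<p] @ [Suc p..<m + 2*n] @ [Suc (m + 2*n)]))"
proof -
  have "pderiv_t 1 (schur_op (int (m + 2*n - p)) (tau mu (int n) m)) t =
      pderiv_t 1 (\<lambda>t. (-1) ^ (m + 2*n - p) * pf n (skip m p) t) t"
    using t p by (intro pderiv_t_cong schur_op_tau) auto
  also have "\<dots> = (-1) ^ (m + 2*n - p) * pderiv_t 1 (pf n (skip m p)) t"
    using t by (intro pderiv_t_scale[of n] pf_span.base) auto
  finally show ?thesis
    by (simp only: pderiv_t_1_pf_skip[OF assms])
qed

text \<open>Each product contains \<open>p\<close> in exactly one factor, so moving it behind
  \<open>ys\<close> gives the same sign throughout; \<open>m\<close> passes the even number of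
  entries of \<open>xs @ ys\<close> without a sign.\<close>

lemma pluecker_skip:
  assumes t: "t \<in> U" and len: "even (length xs + length ys)"
  shows "pfl t (xs @ p # ys @ [q]) * pfl t (m # xs @ ys @ [r]) - pfl t (xs @ p # ys @ [r]) * pfl t (m # xs @ ys @ [q]) =
    pfl t (m # xs @ p # ys @ [q, r]) * pfl t (xs @ ys) - pfl t (m # xs @ p # ys) * pfl t (xs @ ys @ [q, r])"
proof -
  let ?s = "(-1) ^ length ys :: real"
  have p: "pfl t (xs @ p # ys @ zs) = ?s * pfl t ((xs @ ys) @ p # zs)" if "odd (length zs)" for zs
    using pfaffian_list_move[of xs ys zs] that len by simp
  have m: "pfl t (m # xs @ ys @ zs) = pfl t ((xs @ ys) @ m # zs)" if "odd (length zs)" for zs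
    using pfaffian_list_move[of "[]" "xs @ ys" zs] that len by simp
  have mp: "pfl t (m # xs @ p # ys @ zs) = ?s * pfl t ((xs @ ys) @ m # p # zs)" if "even (length zs)" for zs
    using pfaffian_list_move[of "m # xs" ys zs] m[of "p # zs"] that len by simp
  let ?A = "\<lambda>zs. pfl t ((xs @ ys) @ zs)"
  have "?A [p, q] * ?A [m, r] - ?A [p, r] * ?A [m, q] = ?A [m, p, q, r] * ?A [] - ?A [m, p] * ?A [q, r]"
    using pfaffian_pluecker[of "\<lambda>i j. mu i j t" "xs @ ys" m p q r, OF skew[OF t]] len
    by (simp add: algebra_simps)
  then have "?s * (?A [p, q] * ?A [m, r] - ?A [p, r] * ?A [m, q]) =
      ?s * (?A [m, p, q, r] * ?A [] - ?A [m, p] * ?A [q, r])"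
    by (simp only:)
  then show ?thesis
    using p[of "[q]"] p[of "[r]"] m[of "[q]"] m[of "[r]"] mp[of "[]"] mp[of "[q, r]"]
    by (simp add: algebra_simps)
qed

lemma tau_bilinear_identity_interior:
  assumes t: "t \<in> U" and l: "1 \<le> l" "l < 2*n"
  shows "tau mu (int n) (m + 1) t * schur_op (2 * int n + 1 - int l) (tau mu (int n) m) t
    + tau mu (int n) (m + 1) t * pderiv_t 1 (schur_op (2 * int n - int l) (tau mu (int n) m)) t
    - pderiv_t 1 (tau mu (int n) (m + 1)) t * schur_op (2 * int n - int l) (tau mu (int n) m) t
    = tau mu (int n) m t * schur_op (2 * int n + 1 - int l) (tau mu (int n) (m + 1)) t
    - tau mu (int n + 1) m t * schur_op (2 * int n - 1 - int l) (tau mu (int n - 1) (m + 1)) t"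
proof -
  \<comment> \<open>\<open>p\<close> is the gap belonging to l; \<open>q\<close> and
    \<open>r\<close> are the two indices that follow the run m, ..., m+2n-1. The base of the
    Pluecker relation is \<open>xs @ ys\<close>, the inner indices without \<open>p\<close>.\<close>
  define p q r where "p = m + l" and "q = m + 2*n" and "r = Suc q"
  define xs ys where "xs = [Suc m..<p]" and "ys = [Suc p..<q]"
  define k where "k = 2*n - l"
  let ?e = "(-1) ^ k :: real"
  have len: "even (length xs + length ys)"
    using l by (simp add: xs_def ys_def p_def q_def)
  have pq: "m < p" "p < q"
    using l by (simp_all add: p_def q_def)
  have split: "[i..<j] = [i..<p] @ p # [Suc p..<j]" if "i \<le> p" "p < j" for i j
    using upt_add_eq_append[of i p "j - p"] upt_conv_Cons[of p j] that by simp
  have first: "[m..<p] = m # xs"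
    using pq by (simp add: xs_def upt_conv_Cons)
  have last: "[Suc p..<Suc q] = ys @ [q]" "[Suc p..<Suc r] = ys @ [q, r]"
    using pq by (simp_all add: ys_def r_def)
  have lists: "[m..<p] = m # xs" "[Suc p..<Suc q] = ys @ [q]" "[Suc p..<Suc r] = ys @ [q, r]"
    "[m..<q] = m # xs @ p # ys" "[m..<Suc r] = m # xs @ p # ys @ [q, r]"
    "[Suc m..<r] = xs @ p # ys @ [q]" "[Suc m..<q] = xs @ p # ys"
    using pq first last split[of m q] split[of m "Suc r"] split[of "Suc m" r] split[of "Suc m" q]
    by (simp_all add: r_def xs_def ys_def del: upt_Suc)
  have ints: "2 * int n + 1 - int l = int (Suc k)" "2 * int n - int l = int k" "2 * int n - 1 - int l = int (k - 1)"
    "int n + 1 = int (Suc n)" "int n - 1 = int (n - 1)"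
    using l by (auto simp: k_def)
  have k: "k \<ge> 1" "m + 2*n - (p - 1) = Suc k" "m + 2*n - p = k" "m + 1 + 2*n - p = Suc k" "m + 1 + 2*(n - 1) - p = k - 1"
    using l by (simp_all add: p_def k_def)
  have p: "m \<le> p" "p \<le> m + 2*n" "m \<le> p - 1" "p - 1 \<le> m + 2*n" "m + 1 \<le> p" "p \<le> m + 1 + 2*n"
    "p \<le> m + 1 + 2*(n - 1)" "p < m + 2*n"
    using l by (simp_all add: p_def)
  \<comment> \<open>This Pfaffian with gap p - 1 enters the first summand and the derivative in the
    second with opposite signs, and cancels.\<close>
  define z where "z = pf n (skip m (p - 1)) t"
  have 1: "tau mu (int n) (m + 1) t = pfl t (xs @ p # ys @ [q])"
  proof -
    have "[m + 1..<m + 1 + 2*n] = xs @ p # ys @ [q]"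
      using lists(6) by (simp add: r_def q_def del: upt_Suc)
    then show ?thesis
      by (simp only: pfaffian_tau_list)
  qed
  have 2: "schur_op (int (Suc k)) (tau mu (int n) m) t = - ?e * z"
    unfolding schur_op_tau[OF t p(3,4), unfolded k] z_def by simp
  have 3: "pderiv_t 1 (schur_op (int k) (tau mu (int n) m)) t = ?e * (z + pfl t (m # xs @ ys @ [r]))"
    unfolding pderiv_t_1_schur_op_tau[OF t pq(1) p(8), unfolded k] z_def first ys_def r_def q_def by simp
  have 4: "pderiv_t 1 (tau mu (int n) (m + 1)) t = pfl t (xs @ p # ys @ [r])"
  proof -
    have "[m + 1..<m + 1 + 2*n - 1] @ [m + 1 + 2*n] = xs @ p # ys @ [r]"
      using lists(7) by (simp add: q_def r_def)
    moreover have "n \<ge> 1"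
      using l by simp
    ultimately show ?thesis
      by (simp only: pderiv_t_1_tau[OF t])
  qed
  have 5: "schur_op (int k) (tau mu (int n) m) t = ?e * pfl t (m # xs @ ys @ [q])"
    unfolding schur_op_tau_list[OF t p(1,2), unfolded k] first last[unfolded q_def] q_def by simp
  have 6: "tau mu (int n) m t = pfl t (m # xs @ p # ys)"
    unfolding pfaffian_tau_list lists(4)[unfolded q_def] ..
  have 7: "schur_op (int (Suc k)) (tau mu (int n) (m + 1)) t = - ?e * pfl t (xs @ ys @ [q, r])"
  proof -
    have "[m + 1..<p] @ [Suc p..<Suc (m + 1 + 2*n)] = xs @ ys @ [q, r]"
      using last(2) by (simp add: xs_def q_def r_def del: upt_Suc)
    then show ?thesis
      unfolding schur_op_tau_list[OF t p(5,6), unfolded k] by simp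
  qed
  have 8: "tau mu (int (Suc n)) m t = pfl t (m # xs @ p # ys @ [q, r])"
  proof -
    have "[m..<m + 2 * Suc n] = m # xs @ p # ys @ [q, r]"
      using lists(5) by (simp add: q_def r_def del: upt_Suc)
    then show ?thesis
      by (simp only: pfaffian_tau_list)
  qed
  have 9: "schur_op (int (k - 1)) (tau mu (int (n - 1)) (m + 1)) t = - ?e * pfl t (xs @ ys)"
  proof -
    have "Suc (m + 1 + 2*(n - 1)) = q"
      using l by (simp add: q_def)
    then have "[m + 1..<p] @ [Suc p..<Suc (m + 1 + 2*(n - 1))] = xs @ ys"
      by (simp add: xs_def ys_def del: upt_Suc)
    moreover have "(-1) ^ (k - 1) = - ?e"
      using k(1) by (cases k) simp_all
    ultimately show ?thesis
      unfolding schur_op_tau_list[OF t p(5,7), unfolded k] by simp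
  qed
  have "?e * (pfl t (xs @ p # ys @ [q]) * pfl t (m # xs @ ys @ [r]) - pfl t (xs @ p # ys @ [r]) * pfl t (m # xs @ ys @ [q])) =
    ?e * (pfl t (m # xs @ p # ys @ [q, r]) * pfl t (xs @ ys) - pfl t (m # xs @ p # ys) * pfl t (xs @ ys @ [q, r]))"
    unfolding pluecker_skip[OF t len] ..
  then show ?thesis
    unfolding ints 1 2 3 4 5 6 7 8 9 by (simp add: algebra_simps)
qed

text \<open>At the ends the identity degenerates. For l = 2n+1 both sides are the product of the two
  tau functions, for l = 2n it is s_1 = -d/dt_1, and for l = 0 the derivative terms cancel while
  every other operator has degree above the size of its Pfaffian.\<close>

lemma tau_bilinear_identity:
  assumes t: "t \<in> U" and l: "l \<le> 2*n + 1"
  shows "tau mu (int n) (m + 1) t * schur_op (2 * int n + 1 - int l) (tau mu (int n) m) t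
    + tau mu (int n) (m + 1) t * pderiv_t 1 (schur_op (2 * int n - int l) (tau mu (int n) m)) t
    - pderiv_t 1 (tau mu (int n) (m + 1)) t * schur_op (2 * int n - int l) (tau mu (int n) m) t
    = tau mu (int n) m t * schur_op (2 * int n + 1 - int l) (tau mu (int n) (m + 1)) t
    - tau mu (int n + 1) m t * schur_op (2 * int n - 1 - int l) (tau mu (int n - 1) (m + 1)) t"
proof -
  \<comment> \<open>For n = 0 the value l = 0 falls under l = 2n.\<close>
  consider "l = 2*n + 1" | "l = 2*n" | "1 \<le> l" "l < 2*n" | "l = 0" "n \<ge> 1"
    using l by linarith
  then show ?thesis
  proof cases
    case 1
    then show ?thesis
      by (simp add: schur_op_neg schur_op_0 pderiv_t_zero)
  next
    case 2
    then show ?thesis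
      using schur_op_1_tau[OF t] by (simp add: schur_op_neg schur_op_0 algebra_simps)
  next
    case 3
    then show ?thesis
      by (rule tau_bilinear_identity_interior[OF t])
  next
    case 4
    \<comment> \<open>The gap reaches the first index \<open>m\<close>, leaving m+1, ..., m+2n; the
      sign is (-1)^(2n) = 1.\<close>
    have top: "schur_op (2 * int n) (tau mu (int n) m) s = tau mu (int n) (m + 1) s" if "s \<in> U" for s
    proof -
      have "pf n (skip m m) s = tau mu (int n) (m + 1) s"
        unfolding tau_eq_pf pf_def by (intro pfaffian_cong) (simp add: skip_def)
      then show ?thesis
        using schur_op_tau[OF that, of m m n] by simp
    qed
    then have deriv: "pderiv_t 1 (schur_op (2 * int n) (tau mu (int n) m)) t = pderiv_t 1 (tau mu (int n) (m + 1)) t"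
      using t by (intro pderiv_t_cong) auto
    have ints: "2 * int n + 1 - int l = int (2*n + 1)" "2 * int n - int l = 2 * int n"
      "2 * int n - 1 - int l = int (2*n - 1)" "int n - 1 = int (n - 1)"
      using 4 by auto
    show ?thesis
      unfolding ints top[OF t] deriv using t 4(2) by (simp add: schur_op_tau_eq_0 del: of_nat_diff of_nat_Suc of_nat_add)
  qed
qed

end

theorem mainTheorem4:
  fixes mu :: "nat \<Rightarrow> nat \<Rightarrow> times \<Rightarrow> real"
    and U :: "times set"
  assumes "open_in_times U"
    and smooth: "\<And>i j. smooth_in_times U (mu i j)"
    and skew: "\<And>i j t. t \<in> U \<Longrightarrow> mu i j t = - mu j i t"
    and evolution: "\<And>l i j t. l \<ge> 1 \<Longrightarrow> t \<in> U \<Longrightarrow>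
          pderiv_t l (mu i j) t = mu (i + l) j t + mu i (j + l) t"
    and nonzero: "\<And>n m t. t \<in> U \<Longrightarrow> tau mu (int n) m t \<noteq> 0"
  shows "\<forall>(n::nat) (m::nat) (l::nat). l \<le> 2 * n + 1 \<longrightarrow> (\<forall>t\<in>U.
      tau mu (int n) (m + 1) t * schur_op (2 * int n + 1 - int l) (tau mu (int n) m) t
    + tau mu (int n) (m + 1) t * pderiv_t 1 (schur_op (2 * int n - int l) (tau mu (int n) m)) t
    - pderiv_t 1 (tau mu (int n) (m + 1)) t * schur_op (2 * int n - int l) (tau mu (int n) m) t
    = tau mu (int n) m t * schur_op (2 * int n + 1 - int l) (tau mu (int n) (m + 1)) t
    - tau mu (int n + 1) m t * schur_op (2 * int n - 1 - int l) (tau mu (int n - 1) (m + 1)) t)"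
proof -
  interpret skew_bimoment_flow mu U
    using assms(1-4) by unfold_locales
  show ?thesis
    using tau_bilinear_identity by blast
qed

end
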